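(* Let $n\ge 1$ and let $\Omega=\prod_{j=1}^{n}\Omega_j\subset\mathbb{C}^n$, a set of finite volume, be a Cartesian product of planar domains $\Omega_j\subset\mathbb{C}$ of finite area. Then $\Omega$ is a quadrature domain for $H^2$ functions if and only if each of the domains $\Omega_j$ $(j=1,\dots,n)$ is a quadrature domain for $H^2$ functions.
   Context: A domain is a nonempty connected open set. For a domain $\Omega\subset\mathbb{C}^n$ ($n\ge 1$), $H^2(\Omega)$ denotes the Bergman space of holomorphic functions on $\Omega$ that are square-integrable with respect to Lebesgue measure. A domain $\Omega\subset\mathbb{C}^n$ is a quadrature domain (for $H^2$ functions) if there exist finitely many points $z_i\in\Omega$ and finitely many complex constants $c_{i\alpha}$ (with $\alpha$ multi-indices) such that for all $f\in H^2(\Omega)$, $\int_\Omega f\,dV=\sum_{i,\alpha}c_{i\alpha}\frac{\partial^\alpha f}{\partial z^\alpha}(z_i)$, where $dV$ is Lebesgue measure. *)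

theory Defs
  imports "HOL-Complex_Analysis.Complex_Analysis"
begin

definition is_domain :: "'a::topological_space set \<Rightarrow> bool" where
  "is_domain \<Omega> \<longleftrightarrow> open \<Omega> \<and> connected \<Omega> \<and> \<Omega> \<noteq> {}"

definition bergman1 :: "complex set \<Rightarrow> (complex \<Rightarrow> complex) set" where
  "bergman1 \<Omega> = {f. f holomorphic_on \<Omega> \<and> integrable (lebesgue_on \<Omega>) (\<lambda>z. (cmod (f z))\<^sup>2)}"

text \<open>
  A finite set \<open>S\<close> of pairs (node, order of differentiation) indexes the quadrature sum.
  Using \<^const>\<open>has_bochner_integral\<close> makes the existence of the integral part of the identity;
  on domains of finite area it is automatic for square-integrable functions, but in general
  the Bochner integral of a non-integrable function would silently be 0.
\<close>

definition quadrature_domain1 :: "complex set \<Rightarrow> bool" where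
  "quadrature_domain1 \<Omega> \<longleftrightarrow> is_domain \<Omega> \<and>
     (\<exists>(S :: (complex \<times> nat) set) (c :: complex \<Rightarrow> nat \<Rightarrow> complex).
        finite S \<and> S \<subseteq> \<Omega> \<times> UNIV \<and>
        (\<forall>f \<in> bergman1 \<Omega>.
           has_bochner_integral (lebesgue_on \<Omega>) f
             (\<Sum>(z, k)\<in>S. c z k * (deriv ^^ k) f z)))"

text \<open>Real Frechet differentiability with a complex-linear derivative (additivity of \<open>D\<close> is
  part of \<^const>\<open>has_derivative\<close>). Only used on open sets.\<close>

definition holomorphic_several :: "(complex ^ 'n \<Rightarrow> complex) \<Rightarrow> (complex ^ 'n) set \<Rightarrow> bool" where
  "holomorphic_several f \<Omega> \<longleftrightarrow>
     (\<forall>z\<in>\<Omega>. \<exists>D. (f has_derivative D) (at z) \<and> (\<forall>a v. D (a *s v) = a * D v))"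

definition partial_deriv :: "'n \<Rightarrow> (complex ^ 'n \<Rightarrow> complex) \<Rightarrow> complex ^ 'n \<Rightarrow> complex" where
  "partial_deriv j f z = deriv (\<lambda>w. f (\<chi> i. if i = j then w else z $ i)) (z $ j)"

text \<open>
  Partial derivatives commute on holomorphic functions, so the order in which the coordinates
  are processed is immaterial; since the index type carries no order, one enumeration is fixed.
\<close>

definition coord_list :: "'n::finite list" where
  "coord_list = (SOME js. distinct js \<and> set js = UNIV)"

lemma coord_list: "distinct (coord_list :: 'n::finite list)" "set (coord_list :: 'n list) = UNIV"
proof -
  have "\<exists>js :: 'n list. distinct js \<and> set js = UNIV"
    using finite_distinct_list[of "UNIV :: 'n set"] by auto
  from someI_ex[OF this]
  show "distinct (coord_list :: 'n list)" "set (coord_list :: 'n list) = UNIV"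
    unfolding coord_list_def by auto
qed

definition multi_deriv ::
    "('n::finite \<Rightarrow> nat) \<Rightarrow> (complex ^ 'n \<Rightarrow> complex) \<Rightarrow> complex ^ 'n \<Rightarrow> complex" where
  "multi_deriv \<alpha> f = foldr (\<lambda>j. partial_deriv j ^^ \<alpha> j) coord_list f"

definition bergman :: "(complex ^ 'n) set \<Rightarrow> (complex ^ 'n \<Rightarrow> complex) set" where
  "bergman \<Omega> =
     {f. holomorphic_several f \<Omega> \<and> integrable (lebesgue_on \<Omega>) (\<lambda>z. (cmod (f z))\<^sup>2)}"

definition quadrature_domain :: "(complex ^ 'n::finite) set \<Rightarrow> bool" where
  "quadrature_domain \<Omega> \<longleftrightarrow> is_domain \<Omega> \<and>
     (\<exists>(S :: ((complex ^ 'n) \<times> ('n \<Rightarrow> nat)) set) (c :: complex ^ 'n \<Rightarrow> ('n \<Rightarrow> nat) \<Rightarrow> complex).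
        finite S \<and> S \<subseteq> \<Omega> \<times> UNIV \<and>
        (\<forall>f \<in> bergman \<Omega>.
           has_bochner_integral (lebesgue_on \<Omega>) f
             (\<Sum>(z, \<alpha>)\<in>S. c z \<alpha> * multi_deriv \<alpha> f z)))"

end

theory Submission imports Defs begin

text \<open>
  If every factor is a quadrature domain, apply the quadrature functional of the \<open>j\<close>-th factor to
  the \<open>j\<close>-th variable of \<open>f\<close>. By Fubini almost every slice of \<open>f\<close> lies in the Bergman space of the
  factor, so the result agrees almost everywhere with the integral of \<open>f\<close> over that variable. Hence
  it is again square integrable by Cauchy-Schwarz, and it is again holomorphic in each variable. After
  all coordinates are processed a constant remains, which is both the iterated quadrature sum and,
  up to a factor, the integral of \<open>f\<close>. Conversely, a quadrature identity on the product, tested on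
  functions of one variable only, is a quadrature identity on the factor.
\<close>

section \<open>Continuous separately holomorphic functions\<close>

text \<open>Two choices shape the proof. The functionals contain derivatives, so the functions met
  on the way must form a class closed under partial differentiation. Continuous separately
  holomorphic functions are such a class: closure is a one-variable argument with Cauchy estimates,
  and continuity gives Borel measurability. Holomorphy in several variables appears only for the
  test functions.

  Integrating out one coordinate would normally split C^n into C^(n-1) and C, with a smaller index
  type. Instead an idle variable \<open>w\<close> ranging over \<open>D j\<close> is adjoined to the
  whole box, and \<open>exchange\<close> swaps it with the coordinate \<open>j\<close>. All
  functions then stay on the same box for every n, including n = 1. The price is one factor
  \<open>area j\<close> for each processed coordinate. This is the source of the constants
  \<open>K\<close>: \<open>vol\<close> over the product of the areas in one direction,
  \<open>area j / vol\<close> in the other.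

  The functionals are folded along the same \<open>coord_list\<close> as in
  \<open>multi_deriv\<close>, so both sides take the partial derivatives in the same order.\<close>

definition coord_upd :: "complex ^ 'n \<Rightarrow> 'n \<Rightarrow> complex \<Rightarrow> complex ^ 'n" where
  "coord_upd z j w = (\<chi> i. if i = j then w else z $ i)"

lemma coord_upd_nth [simp]: "coord_upd z j w $ i = (if i = j then w else z $ i)"
  by (simp add: coord_upd_def)

lemma coord_upd_same [simp]: "coord_upd z j (z $ j) = z"
  by (simp add: vec_eq_iff)

lemma coord_upd_twice [simp]: "coord_upd (coord_upd z j v) j w = coord_upd z j w"
  by (simp add: vec_eq_iff)

lemma partial_deriv_coord_upd: "partial_deriv j f z = deriv (\<lambda>w. f (coord_upd z j w)) (z $ j)"
  by (simp add: partial_deriv_def coord_upd_def)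

lemma coord_upd_conv_axis: "coord_upd z j w = z + axis j (w - z $ j)"
  by (simp add: vec_eq_iff axis_def)

lemma axis_zero [simp]: "axis j 0 = (0 :: complex ^ 'n)"
  by (simp add: vec_eq_iff axis_def)

lemma norm_axis_complex: "norm (axis j v :: complex ^ 'n::finite) = cmod v"
  by (simp add: norm_vec_def L2_set_def axis_def if_distrib[of norm] if_distrib[of "\<lambda>x. x ^ 2"] cong: if_cong)

lemma dist_coord_upd [simp]: "dist (coord_upd z j v) (coord_upd z j w) = dist v w" for v w :: complex
proof -
  have "coord_upd z j v - coord_upd z j w = axis j (v - w)"
    by (simp add: vec_eq_iff axis_def)
  then show ?thesis
    by (simp add: dist_norm norm_axis_complex)
qed

lemma continuous_on_coord_upd [continuous_intros]:
  fixes g :: "'a::topological_space \<Rightarrow> complex ^ 'n::finite"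
  assumes "continuous_on S g" "continuous_on S h"
  shows "continuous_on S (\<lambda>x. coord_upd (g x) j (h x))"
  unfolding coord_upd_def
proof (rule continuous_on_vec_lambda)
  fix i show "continuous_on S (\<lambda>x. if i = j then h x else g x $ i)"
    using assms by (cases "i = j") (auto intro: continuous_intros)
qed

lemma coord_upd_has_derivative: "(coord_upd z j has_derivative axis j) (at w)"
proof -
  have "coord_upd z j = (\<lambda>w. z + axis j (w - z $ j))"
    by (simp add: fun_eq_iff coord_upd_conv_axis)
  moreover have "bounded_linear (axis j :: complex \<Rightarrow> complex ^ 'a)"
    by (intro bounded_linear_intro[where K = 1]) (auto simp: vec_eq_iff axis_def norm_axis_complex[unfolded axis_def])
  then have "((\<lambda>w. axis j (w - z $ j)) has_derivative axis j) (at w)"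
    by (rule bounded_linear.has_derivative) (auto intro!: derivative_eq_intros)
  ultimately show ?thesis
    by (auto intro: derivative_eq_intros)
qed

text \<open>Continuity is part of the class because it supplies the local bounds for Cauchy's
  inequality and the measurability for Fubini.\<close>

definition sep_holomorphic :: "(complex ^ 'n \<Rightarrow> complex) \<Rightarrow> (complex ^ 'n) set \<Rightarrow> bool" where
  "sep_holomorphic f \<Omega> \<longleftrightarrow> continuous_on \<Omega> f \<and>
     (\<forall>z\<in>\<Omega>. \<forall>j. (\<lambda>w. f (coord_upd z j w)) holomorphic_on {w. coord_upd z j w \<in> \<Omega>})"

lemma sep_holomorphicD:
  assumes "sep_holomorphic f \<Omega>"
  shows "continuous_on \<Omega> f"
    and "z \<in> \<Omega> \<Longrightarrow> (\<lambda>w. f (coord_upd z j w)) holomorphic_on {w. coord_upd z j w \<in> \<Omega>}"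
  using assms by (auto simp: sep_holomorphic_def)

lemma open_slice:
  assumes "open \<Omega>" shows "open {w. coord_upd z j w \<in> \<Omega>}"
proof -
  have "continuous_on UNIV (coord_upd z j)"
    by (intro continuous_intros)
  from open_vimage[OF assms this] show ?thesis
    by (simp add: vimage_def)
qed

lemma holomorphic_several_imp_sep_holomorphic:
  assumes f: "holomorphic_several f \<Omega>"
  shows "sep_holomorphic f \<Omega>"
  unfolding sep_holomorphic_def
proof (intro conjI ballI allI)
  show "continuous_on \<Omega> f"
    using f unfolding holomorphic_several_def
    by (meson continuous_at_imp_continuous_on has_derivative_continuous)
next
  fix z j
  show "(\<lambda>w. f (coord_upd z j w)) holomorphic_on {w. coord_upd z j w \<in> \<Omega>}"
    unfolding holomorphic_on_def
  proof
    fix w assume "w \<in> {w. coord_upd z j w \<in> \<Omega>}"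
    with f obtain D where D: "(f has_derivative D) (at (coord_upd z j w))"
      and lin: "\<And>a v. D (a *s v) = a * D v"
      unfolding holomorphic_several_def by blast
    have "((\<lambda>w. f (coord_upd z j w)) has_derivative (\<lambda>h. D (axis j h))) (at w)"
      using diff_chain_at[OF coord_upd_has_derivative D] by (simp add: o_def)
    moreover have "(\<lambda>h. D (axis j h)) = (*) (D (axis j 1))"
    proof
      fix h
      have "axis j h = h *s axis j (1::complex)"
        by (simp add: vec_eq_iff axis_def)
      then show "D (axis j h) = D (axis j 1) * h" by (simp add: lin)
    qed
    ultimately have "((\<lambda>w. f (coord_upd z j w)) has_field_derivative D (axis j 1)) (at w)"
      by (simp add: has_field_derivative_def)
    then show "(\<lambda>w. f (coord_upd z j w)) field_differentiable at w within {w. coord_upd z j w \<in> \<Omega>}"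
      using field_differentiable_at_within field_differentiable_def by blast
  qed
qed

text \<open>Taylor's formula of order one, with the second derivative controlled by Cauchy's
  inequality. The bound sees \<open>g\<close> only through \<open>B\<close> and \<open>r\<close>,
  hence it is uniform over all slices of a function that is bounded near a point.\<close>

lemma difference_quotient_bound:
  assumes g: "g holomorphic_on ball u r" and r: "0 < r"
    and B: "\<And>w. w \<in> ball u r \<Longrightarrow> cmod (g w) \<le> B"
    and h: "h \<noteq> 0" "cmod h < r / 2"
  shows "cmod ((g (u + h) - g u) / h - deriv g u) \<le> 32 * B / r\<^sup>2 * cmod h"
proof -
  \<comment> \<open>Circles of radius \<open>r / 4\<close> around points of the half disc stay
    inside the disc, and \<open>fact 2 * B / (r / 4) ^ 2\<close> is
    \<open>32 * B / r\<^sup>2\<close>.\<close>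
  have d2: "cmod ((deriv ^^ 2) g x) \<le> 32 * B / r\<^sup>2" if x: "x \<in> ball u (r / 2)" for x
  proof -
    have sub: "cball x (r / 4) \<subseteq> ball u r"
    proof
      fix y assume "y \<in> cball x (r / 4)"
      with x r show "y \<in> ball u r"
        using dist_triangle[of u y x] by (auto simp: dist_commute)
    qed
    have "norm ((deriv ^^ 2) g x) \<le> fact 2 * B / (r / 4) ^ 2"
    proof (rule Cauchy_inequality)
      show "g holomorphic_on ball x (r / 4)" "continuous_on (cball x (r / 4)) g"
        using holomorphic_on_subset[OF g order_trans[OF ball_subset_cball sub]]
          continuous_on_subset[OF holomorphic_on_imp_continuous_on[OF g] sub] by auto
      show "norm (g y) \<le> B" if "norm (x - y) = r / 4" for y
        using sub that by (intro B) (auto simp: dist_norm)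
    qed (use r in auto)
    then show ?thesis by (simp add: power2_eq_square)
  qed
  have "cmod ((deriv ^^ 0) g (u + h) - (\<Sum>i\<le>1. (deriv ^^ i) g u * (u + h - u) ^ i / fact i))
      \<le> (32 * B / r\<^sup>2) * cmod (u + h - u) ^ Suc 1 / fact 1"
  proof (rule complex_Taylor)
    fix i x assume x: "x \<in> ball u (r / 2)" "i \<le> (1::nat)"
    have "(deriv ^^ i) g holomorphic_on ball u r"
      by (intro holomorphic_higher_deriv g) auto
    with x r have "((deriv ^^ i) g has_field_derivative deriv ((deriv ^^ i) g) x) (at x)"
      by (intro holomorphic_derivI[of _ "ball u r"]) auto
    then show "((deriv ^^ i) g has_field_derivative (deriv ^^ Suc i) g x) (at x within ball u (r / 2))"
      by (simp add: has_field_derivative_at_within)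
  qed (use h r d2 in \<open>auto simp: dist_norm numeral_2_eq_2\<close>)
  then have *: "cmod (g (u + h) - g u - deriv g u * h) \<le> 32 * B / r\<^sup>2 * cmod h * cmod h"
    by (simp add: power2_eq_square algebra_simps)
  have "(g (u + h) - g u) / h - deriv g u = (g (u + h) - g u - deriv g u * h) / h"
    using h by (simp add: field_simps)
  then have "cmod ((g (u + h) - g u) / h - deriv g u) = cmod (g (u + h) - g u - deriv g u * h) / cmod h"
    by (simp add: norm_divide)
  also have "\<dots> \<le> 32 * B / r\<^sup>2 * cmod h"
    using * h by (simp add: pos_divide_le_eq)
  finally show ?thesis .
qed

lemma sep_holomorphic_translate:
  assumes f: "sep_holomorphic f \<Omega>" and sub: "\<And>z. z \<in> U \<Longrightarrow> z + axis j h \<in> \<Omega>"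
  shows "sep_holomorphic (\<lambda>z. f (z + axis j h)) U"
  unfolding sep_holomorphic_def
proof (intro conjI ballI allI)
  show "continuous_on U (\<lambda>z. f (z + axis j h))"
    by (rule continuous_on_compose2[OF sep_holomorphicD(1)[OF f]])
      (auto intro!: continuous_intros sub)
next
  fix z i assume z: "z \<in> U"
  let ?d = "if i = j then h else 0"
  have eq: "coord_upd z i w + axis j h = coord_upd (z + axis j h) i (w + ?d)" for w
    by (simp add: vec_eq_iff axis_def)
  have "(\<lambda>w. f (coord_upd (z + axis j h) i w)) \<circ> (\<lambda>w. w + ?d) holomorphic_on {w. coord_upd z i w \<in> U}"
  proof (rule holomorphic_on_compose)
    show "(\<lambda>w. w + ?d) holomorphic_on {w. coord_upd z i w \<in> U}"
      by (intro holomorphic_intros)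
    have "(\<lambda>w. f (coord_upd (z + axis j h) i w)) holomorphic_on {w. coord_upd (z + axis j h) i w \<in> \<Omega>}"
      using f sub[OF z] by (rule sep_holomorphicD)
    then show "(\<lambda>w. f (coord_upd (z + axis j h) i w)) holomorphic_on
        (\<lambda>w. w + ?d) ` {w. coord_upd z i w \<in> U}"
    proof (rule holomorphic_on_subset)
      show "(\<lambda>w. w + ?d) ` {w. coord_upd z i w \<in> U} \<subseteq> {w. coord_upd (z + axis j h) i w \<in> \<Omega>}"
        unfolding image_subset_iff mem_Collect_eq eq[symmetric] by (blast intro: sub)
    qed
  qed
  then show "(\<lambda>w. f (coord_upd z i w + axis j h)) holomorphic_on {w. coord_upd z i w \<in> U}"
    unfolding eq by (simp add: o_def)
qed

lemma sep_holomorphic_subset: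
  assumes "sep_holomorphic f \<Omega>" "U \<subseteq> \<Omega>"
  shows "sep_holomorphic f U"
  using assms unfolding sep_holomorphic_def
  by (force intro: continuous_on_subset elim!: holomorphic_on_subset)

lemma sep_holomorphic_add:
  "sep_holomorphic f \<Omega> \<Longrightarrow> sep_holomorphic g \<Omega> \<Longrightarrow> sep_holomorphic (\<lambda>z. f z + g z) \<Omega>"
  unfolding sep_holomorphic_def by (auto intro!: holomorphic_intros continuous_intros)

lemma sep_holomorphic_cmult: "sep_holomorphic f \<Omega> \<Longrightarrow> sep_holomorphic (\<lambda>z. c * f z) \<Omega>"
  unfolding sep_holomorphic_def by (auto intro!: holomorphic_intros continuous_intros)

lemma sep_holomorphic_sum:
  "(\<And>s. s \<in> S \<Longrightarrow> sep_holomorphic (f s) \<Omega>) \<Longrightarrow> sep_holomorphic (\<lambda>z. \<Sum>s\<in>S. f s z) \<Omega>"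
  unfolding sep_holomorphic_def by (auto intro!: holomorphic_intros continuous_intros)

text \<open>Difference quotients are separately holomorphic, and by Cauchy's bound on the second
  derivative they converge locally uniformly.\<close>

lemma partial_deriv_local_uniform_limit:
  fixes f :: "complex ^ 'n::finite \<Rightarrow> complex"
  assumes f: "sep_holomorphic f \<Omega>" and \<Omega>: "open \<Omega>" and z0: "z0 \<in> \<Omega>"
  obtains r q where "0 < r" "ball z0 r \<subseteq> \<Omega>" "\<And>n::nat. sep_holomorphic (q n) (ball z0 r)"
    "uniform_limit (ball z0 r) q (partial_deriv j f) sequentially"
proof -
  obtain e where e: "0 < e" "cball z0 e \<subseteq> \<Omega>"
    using \<Omega> z0 by (meson open_contains_cball)
  \<comment> \<open>With half the radius, a point of \<open>ball z0 r\<close> moved by less than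
    \<open>r\<close> stays in the compact ball of radius \<open>2 * r\<close>, where
    \<open>f\<close> is bounded.\<close>
  define r where "r = e / 2"
  have r: "0 < r" "cball z0 (2 * r) \<subseteq> \<Omega>"
    using e by (auto simp: r_def)
  have "compact (f ` cball z0 (2 * r))"
    by (intro compact_continuous_image continuous_on_subset[OF sep_holomorphicD(1)[OF f]] r) auto
  then obtain B where B: "\<And>z. z \<in> cball z0 (2 * r) \<Longrightarrow> cmod (f z) \<le> B"
    by (meson bounded_iff compact_imp_bounded image_eqI)
  \<comment> \<open>The summand 3 keeps the increment below \<open>r / 2\<close> already for
    \<open>n = 0\<close>, as \<open>difference_quotient_bound\<close> demands.\<close>
  define h :: "nat \<Rightarrow> complex" where "h n = of_real (r / (real n + 3))" for n
  have cmod_h: "cmod (h n) = r / (real n + 3)" for n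
    unfolding h_def norm_of_real using r by simp
  have h: "h n \<noteq> 0" "cmod (h n) < r / 2" for n
  proof -
    have "0 < cmod (h n)" "cmod (h n) < r / 2"
      unfolding cmod_h using r by (simp_all add: field_simps add_pos_nonneg)
    then show "h n \<noteq> 0" "cmod (h n) < r / 2" by auto
  qed
  define q where "q n z = (f (z + axis j (h n)) - f z) / h n" for n z
  have near: "z + axis j v \<in> cball z0 (2 * r)" if "z \<in> ball z0 r" "cmod v < r" for z v
  proof -
    have "dist z0 (z + axis j v) \<le> dist z0 z + dist z (z + axis j v)"
      by (rule dist_triangle)
    also have "dist z (z + axis j v) = cmod v"
      by (simp add: dist_norm norm_axis_complex)
    finally show ?thesis using that by auto
  qed
  have sub: "ball z0 r \<subseteq> \<Omega>"
    using near[of _ 0] r by (auto simp: axis_def vec_eq_iff zero_vec_def[symmetric])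
  have "sep_holomorphic (q n) (ball z0 r)" for n
  proof -
    have "sep_holomorphic (\<lambda>z. inverse (h n) * (f (z + axis j (h n)) + (- 1) * f z)) (ball z0 r)"
      using h(2)[of n] r
      by (intro sep_holomorphic_cmult sep_holomorphic_add sep_holomorphic_translate[OF f]
          sep_holomorphic_subset[OF f sub] set_mp[OF r(2)] near) auto
    then show ?thesis
      by (simp add: q_def[abs_def] field_simps)
  qed
  moreover have "uniform_limit (ball z0 r) q (partial_deriv j f) sequentially"
  proof (rule uniform_limitI)
    fix \<epsilon> :: real assume \<epsilon>: "0 < \<epsilon>"
    have "filterlim (\<lambda>n. real n + 3) at_top sequentially"
      using filterlim_tendsto_add_at_top[OF tendsto_const filterlim_real_sequentially, of 3] by (simp add: add.commute)
    then have "(\<lambda>n. 32 * B / r\<^sup>2 * (r / (real n + 3))) \<longlonglongrightarrow> 32 * B / r\<^sup>2 * 0"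
      by (intro tendsto_mult_left tendsto_divide_0[OF tendsto_const] filterlim_at_top_imp_at_infinity)
    then have "(\<lambda>n. 32 * B / r\<^sup>2 * (r / (real n + 3))) \<longlonglongrightarrow> 0"
      by simp
    then have "\<forall>\<^sub>F n in sequentially. 32 * B / r\<^sup>2 * (r / (real n + 3)) < \<epsilon>"
      using \<epsilon> by (rule order_tendstoD)
    then show "\<forall>\<^sub>F n in sequentially. \<forall>z\<in>ball z0 r. dist (q n z) (partial_deriv j f z) < \<epsilon>"
    proof eventually_elim
      case (elim n)
      show ?case
      proof
        fix z assume z: "z \<in> ball z0 r"
        let ?g = "\<lambda>w. f (coord_upd z j w)"
        have in_cball: "coord_upd z j w \<in> cball z0 (2 * r)" if "w \<in> ball (z $ j) r" for w
          using near[OF z, of "w - z $ j"] that by (simp add: coord_upd_conv_axis dist_norm norm_minus_commute)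
        have "cmod ((?g (z $ j + h n) - ?g (z $ j)) / h n - deriv ?g (z $ j)) \<le> 32 * B / r\<^sup>2 * cmod (h n)"
        proof (rule difference_quotient_bound)
          show "?g holomorphic_on ball (z $ j) r"
            using in_cball r sub z
            by (intro holomorphic_on_subset[OF sep_holomorphicD(2)[OF f, of z j]]) auto
        qed (use r h B in_cball in auto)
        also note cmod_h
        finally show "dist (q n z) (partial_deriv j f z) < \<epsilon>"
          using elim by (simp add: dist_norm q_def partial_deriv_coord_upd coord_upd_conv_axis)
      qed
    qed
  qed
  ultimately show thesis using that r sub by blast
qed

text \<open>Local uniform limits preserve continuity and, by Weierstrass' theorem on each slice,
  holomorphy. The slice direction \<open>i\<close> and the direction \<open>j\<close> of
  differentiation are independent, so the mixed case needs no separate argument.\<close>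

lemma sep_holomorphic_partial_deriv:
  fixes f :: "complex ^ 'n::finite \<Rightarrow> complex"
  assumes f: "sep_holomorphic f \<Omega>" and \<Omega>: "open \<Omega>"
  shows "sep_holomorphic (partial_deriv j f) \<Omega>"
  unfolding sep_holomorphic_def
proof (intro conjI ballI allI)
  show "continuous_on \<Omega> (partial_deriv j f)"
  proof (intro continuous_at_imp_continuous_on ballI)
    fix z0 assume "z0 \<in> \<Omega>"
    from partial_deriv_local_uniform_limit[OF f \<Omega> this] obtain r q where rq: "0 < r"
      "\<And>n::nat. sep_holomorphic (q n) (ball z0 r)"
      "uniform_limit (ball z0 r) q (partial_deriv j f) sequentially"
      by metis
    have "continuous_on (ball z0 r) (partial_deriv j f)"
      by (rule uniform_limit_theorem[OF _ rq(3)]) (auto intro!: always_eventually sep_holomorphicD(1) rq)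
    then show "isCont (partial_deriv j f) z0"
      using rq(1) by (simp add: continuous_on_eq_continuous_at)
  qed
next
  fix z i
  show "(\<lambda>w. partial_deriv j f (coord_upd z i w)) holomorphic_on {w. coord_upd z i w \<in> \<Omega>}"
  proof (unfold holomorphic_on_def, intro ballI)
    fix w0 assume "w0 \<in> {w. coord_upd z i w \<in> \<Omega>}"
    then have z0: "coord_upd z i w0 \<in> \<Omega>" (is "?z0 \<in> \<Omega>") by simp
    from partial_deriv_local_uniform_limit[OF f \<Omega> z0] obtain r q where rq: "0 < r"
      "\<And>n::nat. sep_holomorphic (q n) (ball ?z0 r)"
      "uniform_limit (ball ?z0 r) q (partial_deriv j f) sequentially"
      by metis
    have "(\<lambda>w. partial_deriv j f (coord_upd z i w)) holomorphic_on ball w0 r"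
    proof (rule holomorphic_uniform_sequence[where f = "\<lambda>n w. q n (coord_upd z i w)"])
      fix n
      have "(\<lambda>w. q n (coord_upd ?z0 i w)) holomorphic_on {w. coord_upd ?z0 i w \<in> ball ?z0 r}"
        using rq(1) by (intro sep_holomorphicD rq(2)) auto
      then show "(\<lambda>w. q n (coord_upd z i w)) holomorphic_on ball w0 r"
        \<comment> \<open>The slice through the centre is embedded isometrically, so it meets the
          ball exactly in the disc \<open>ball w0 r\<close>.\<close>
        by (simp add: ball_def)
    next
      fix x assume "x \<in> ball w0 r"
      then obtain d where d: "0 < d" "cball x d \<subseteq> ball w0 r"
        by (meson open_ball open_contains_cball)
      have "uniform_limit (cball x d) (\<lambda>n w. q n (coord_upd z i w))
          (\<lambda>w. partial_deriv j f (coord_upd z i w)) sequentially"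
      proof (rule uniform_limit_compose'[OF rq(3)])
        show "coord_upd z i \<in> cball x d \<rightarrow> ball ?z0 r"
          using d by (auto simp: subset_eq)
      qed
      with d show "\<exists>d>0. cball x d \<subseteq> ball w0 r \<and> uniform_limit (cball x d)
          (\<lambda>n w. q n (coord_upd z i w)) (\<lambda>w. partial_deriv j f (coord_upd z i w)) sequentially"
        by blast
    qed auto
    then show "(\<lambda>w. partial_deriv j f (coord_upd z i w)) field_differentiable
        at w0 within {w. coord_upd z i w \<in> \<Omega>}"
      by (rule field_differentiable_at_within[OF holomorphic_on_imp_differentiable_at[where s = "ball w0 r"]]) (use rq(1) in auto)
  qed
qed

section \<open>Fubini in a single coordinate\<close>

text \<open>Lets the same measure be read as a product, for Fubini, and as a restriction of Lebesgue
  measure on the product space, for invariance under \<open>exchange\<close>.\<close>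

lemma pair_measure_restrict_space:
  assumes M: "sigma_finite_measure M" "A \<in> sets M" and N: "sigma_finite_measure N" "B \<in> sets N"
  shows "restrict_space M A \<Otimes>\<^sub>M restrict_space N B = restrict_space (M \<Otimes>\<^sub>M N) (A \<times> B)"
proof (rule pair_measure_eqI)
  show "sigma_finite_measure (restrict_space M A)" "sigma_finite_measure (restrict_space N B)"
    using assms by (auto intro: sigma_finite_measure_restrict_space)
  have AB: "A \<times> B \<in> sets (M \<Otimes>\<^sub>M N)"
    using assms by auto
  have sub: "A \<subseteq> space M" "B \<subseteq> space N"
    using assms by (auto dest: sets.sets_into_space)
  show "sets (restrict_space M A \<Otimes>\<^sub>M restrict_space N B) = sets (restrict_space (M \<Otimes>\<^sub>M N) (A \<times> B))"
  proof
    show "sets (restrict_space M A \<Otimes>\<^sub>M restrict_space N B) \<subseteq> sets (restrict_space (M \<Otimes>\<^sub>M N) (A \<times> B))"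
      using assms AB by (intro sets_pair_in_sets) (auto simp: sets_restrict_space_iff)
    \<comment> \<open>This inclusion is measurability of the identity, which can be checked on the
      two projections.\<close>
    have "(\<lambda>p. p) \<in> restrict_space M A \<Otimes>\<^sub>M restrict_space N B \<rightarrow>\<^sub>M restrict_space (M \<Otimes>\<^sub>M N) (A \<times> B)"
    proof (rule measurable_restrict_space2)
      have "fst \<in> restrict_space M A \<Otimes>\<^sub>M restrict_space N B \<rightarrow>\<^sub>M M"
        "snd \<in> restrict_space M A \<Otimes>\<^sub>M restrict_space N B \<rightarrow>\<^sub>M N"
        by (rule measurable_compose[OF measurable_fst measurable_restrict_space1[OF measurable_ident_sets[OF refl]]]
            measurable_compose[OF measurable_snd measurable_restrict_space1[OF measurable_ident_sets[OF refl]]])+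
      then show "(\<lambda>p. p) \<in> restrict_space M A \<Otimes>\<^sub>M restrict_space N B \<rightarrow>\<^sub>M M \<Otimes>\<^sub>M N"
        by (simp add: measurable_pair_iff o_def)
    qed (use sub in \<open>auto simp: space_pair_measure space_restrict_space\<close>)
    note id = measurable_sets[OF this]
    have space: "space (restrict_space M A \<Otimes>\<^sub>M restrict_space N B) = A \<times> B"
      using sub by (auto simp: space_pair_measure space_restrict_space)
    show "sets (restrict_space (M \<Otimes>\<^sub>M N) (A \<times> B)) \<subseteq> sets (restrict_space M A \<Otimes>\<^sub>M restrict_space N B)"
    proof
      fix X assume X: "X \<in> sets (restrict_space (M \<Otimes>\<^sub>M N) (A \<times> B))"
      then have "X \<subseteq> A \<times> B"
        using AB by (simp add: sets_restrict_space_iff)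
      then show "X \<in> sets (restrict_space M A \<Otimes>\<^sub>M restrict_space N B)"
        using id[OF X] by (simp add: space vimage_def Int_absorb2)
    qed
  qed
  fix X Y assume "X \<in> sets (restrict_space M A)" "Y \<in> sets (restrict_space N B)"
  then have XY: "X \<subseteq> A" "X \<in> sets M" "Y \<subseteq> B" "Y \<in> sets N"
    using assms by (auto simp: sets_restrict_space_iff)
  then have "emeasure (restrict_space (M \<Otimes>\<^sub>M N) (A \<times> B)) (X \<times> Y) = emeasure (M \<Otimes>\<^sub>M N) (X \<times> Y)"
    using AB by (intro emeasure_restrict_space) auto
  then show "emeasure (restrict_space M A) X * emeasure (restrict_space N B) Y
      = emeasure (restrict_space (M \<Otimes>\<^sub>M N) (A \<times> B)) (X \<times> Y)"
    using assms XY by (simp add: emeasure_restrict_space sigma_finite_measure.emeasure_pair_measure_Times)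
qed

lemma distr_restrict_space_invariant:
  assumes T: "T \<in> L \<rightarrow>\<^sub>M L" "distr L L T = L" and C: "C \<in> sets L" "\<And>p. p \<in> space L \<Longrightarrow> T p \<in> C \<longleftrightarrow> p \<in> C"
  shows "T \<in> restrict_space L C \<rightarrow>\<^sub>M restrict_space L C"
    and "distr (restrict_space L C) (restrict_space L C) T = restrict_space L C"
proof -
  have sub: "C \<subseteq> space L"
    using C by (auto dest: sets.sets_into_space)
  show meas: "T \<in> restrict_space L C \<rightarrow>\<^sub>M restrict_space L C"
    using T(1) C(2) sub by (intro measurable_restrict_space2 measurable_restrict_space1)
      (auto simp: space_restrict_space)
  show "distr (restrict_space L C) (restrict_space L C) T = restrict_space L C"
  proof (rule measure_eqI)
    fix X assume "X \<in> sets (distr (restrict_space L C) (restrict_space L C) T)"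
    then have X: "X \<in> sets (restrict_space L C)" "X \<in> sets L" "X \<subseteq> C"
      using C by (auto simp: sets_restrict_space_iff)
    have "emeasure (distr (restrict_space L C) (restrict_space L C) T) X
        = emeasure (restrict_space L C) (T -` X \<inter> space (restrict_space L C))"
      using X meas by (intro emeasure_distr)
    also have "T -` X \<inter> space (restrict_space L C) = T -` X \<inter> space L"
      using X C(2) sub by (auto simp: space_restrict_space)
    also have "emeasure (restrict_space L C) (T -` X \<inter> space L) = emeasure L (T -` X \<inter> space L)"
      using X C by (intro emeasure_restrict_space) auto
    also have "\<dots> = emeasure (distr L L T) X"
      using T(1) X(2) by (rule emeasure_distr[symmetric])
    also have "\<dots> = emeasure L X"
      by (simp only: T(2))
    also have "\<dots> = emeasure (restrict_space L C) X"
      using X C by (simp add: emeasure_restrict_space)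
    finally show "emeasure (distr (restrict_space L C) (restrict_space L C) T) X
        = emeasure (restrict_space L C) X" .
  qed simp
qed

lemma has_bochner_integral_pair_fst:
  fixes f :: "'a \<Rightarrow> 'b::{banach, second_countable_topology}"
  assumes M: "sigma_finite_measure M" and N: "finite_measure N"
    and f: "has_bochner_integral M f x"
  shows "has_bochner_integral (M \<Otimes>\<^sub>M N) (\<lambda>p. f (fst p)) (measure N (space N) *\<^sub>R x)"
proof -
  interpret N: finite_measure N by fact
  interpret M: sigma_finite_measure M by fact
  interpret pair_sigma_finite M N ..
  have f': "integrable M f" "integral\<^sup>L M f = x"
    using f by (auto simp: has_bochner_integral_iff)
  then have [measurable]: "f \<in> borel_measurable M" by auto
  have "integrable (M \<Otimes>\<^sub>M N) (\<lambda>p. f (fst p))"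
    using f' by (intro Fubini_integrable) auto
  with integral_fst'[OF this] f' show ?thesis
    by (simp add: has_bochner_integral_iff)
qed

lemma has_bochner_integral_pair_snd:
  fixes f :: "'a \<Rightarrow> 'b::{banach, second_countable_topology}"
  assumes M: "finite_measure M" and N: "sigma_finite_measure N"
    and f: "has_bochner_integral N f x"
  shows "has_bochner_integral (M \<Otimes>\<^sub>M N) (\<lambda>p. f (snd p)) (measure M (space M) *\<^sub>R x)"
proof -
  interpret M: finite_measure M by fact
  interpret N: sigma_finite_measure N by fact
  interpret pair_sigma_finite M N ..
  have f': "integrable N f" "integral\<^sup>L N f = x"
    using f by (auto simp: has_bochner_integral_iff)
  then have [measurable]: "f \<in> borel_measurable N" by auto
  have "integrable (M \<Otimes>\<^sub>M N) (\<lambda>p. f (snd p))"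
    using f' by (intro Fubini_integrable) auto
  with integral_fst'[OF this] f' show ?thesis
    by (simp add: has_bochner_integral_iff)
qed

text \<open>Exchanging the coordinate \<open>j\<close> of
  \<open>z\<close> with an additional variable \<open>w\<close> permutes the standard basis, hence preserves Lebesgue
  measure.\<close>

definition exchange :: "'n \<Rightarrow> (complex ^ 'n) \<times> complex \<Rightarrow> (complex ^ 'n) \<times> complex" where
  "exchange j p = (coord_upd (fst p) j (snd p), fst p $ j)"

lemma exchange_exchange [simp]: "exchange j (exchange j p) = p"
  by (cases p) (simp add: exchange_def vec_eq_iff)

lemma measurable_exchange [measurable]: "(exchange j :: (complex ^ 'n::finite) \<times> complex \<Rightarrow> _) \<in> borel \<rightarrow>\<^sub>M borel"
  unfolding exchange_def by (intro borel_measurable_continuous_onI continuous_intros)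

text \<open>An involution that permutes an orthonormal basis is self-adjoint. This is what turns
  preimages of boxes into boxes.\<close>

lemma inner_exchange: "exchange j p \<bullet> q = p \<bullet> exchange j q" for p q :: "(complex ^ 'n::finite) \<times> complex"
proof -
  have inner_upd: "coord_upd z j w \<bullet> y = w \<bullet> y $ j + (\<Sum>i\<in>UNIV - {j}. z $ i \<bullet> y $ i)"
    for z y :: "complex ^ 'n" and w
    by (simp add: inner_vec_def sum.remove[of UNIV j])
  obtain z w where p: "p = (z, w)" by (cases p)
  obtain y v where q: "q = (y, v)" by (cases q)
  have "z \<bullet> coord_upd y j v = z $ j \<bullet> v + (\<Sum>i\<in>UNIV - {j}. z $ i \<bullet> y $ i)"
    by (simp add: inner_vec_def sum.remove[of UNIV j])
  then show ?thesis
    by (simp add: p q exchange_def inner_upd)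
qed

lemma exchange_Basis: "exchange j b \<in> Basis" if "b \<in> Basis" for b :: "(complex ^ 'n::finite) \<times> complex"
proof -
  from that consider i e where "b = (axis i e, 0)" "e \<in> Basis" | e where "b = (0, e)" "e \<in> Basis"
    by (auto simp: Basis_prod_def Basis_vec_def)
  then show ?thesis
  proof cases
    case 1
    then have "exchange j b = (if i = j then (0, e) else (axis i e, 0))"
      by (auto simp: exchange_def vec_eq_iff axis_def)
    with 1 show ?thesis
      by (auto simp: Basis_prod_def Basis_vec_def)
  next
    case 2
    then have "exchange j b = (axis j e, 0)"
      by (auto simp: exchange_def vec_eq_iff axis_def)
    with 2 show ?thesis
      by (auto simp: Basis_prod_def Basis_vec_def)
  qed
qed

lemma bij_betw_exchange_Basis:
  "bij_betw (exchange j) (Basis :: ((complex ^ 'n::finite) \<times> complex) set) Basis"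
  by (rule bij_betw_byWitness[where f' = "exchange j"]) (auto simp: exchange_Basis)

text \<open>Lebesgue measure is determined by its values on boxes, and \<open>exchange\<close> only
  permutes the side lengths of a box.\<close>

lemma distr_lborel_exchange:
  "distr lborel lborel (exchange j) = (lborel :: ((complex ^ 'n::finite) \<times> complex) measure)"
proof (rule lborel_eqI[symmetric])
  fix l u :: "(complex ^ 'n) \<times> complex"
  assume le: "\<And>b. b \<in> Basis \<Longrightarrow> l \<bullet> b \<le> u \<bullet> b"
  have "exchange j p \<in> box l u \<longleftrightarrow> p \<in> box (exchange j l) (exchange j u)" for p
  proof -
    have "exchange j p \<in> box l u \<longleftrightarrow>
        (\<forall>b\<in>Basis. exchange j l \<bullet> exchange j b < p \<bullet> exchange j b \<and> p \<bullet> exchange j b < exchange j u \<bullet> exchange j b)"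
      by (simp add: mem_box inner_exchange)
    also have "\<dots> \<longleftrightarrow> (\<forall>b\<in>exchange j ` Basis. exchange j l \<bullet> b < p \<bullet> b \<and> p \<bullet> b < exchange j u \<bullet> b)"
      by blast
    also have "exchange j ` Basis = Basis"
      using bij_betw_exchange_Basis by (rule bij_betw_imp_surj_on)
    finally show ?thesis by (simp add: mem_box)
  qed
  then have vimage: "exchange j -` box l u = box (exchange j l) (exchange j u)"
    by (intro set_eqI) (simp only: vimage_eq)
  have "emeasure (distr lborel lborel (exchange j)) (box l u) = emeasure lborel (box (exchange j l) (exchange j u))"
    by (simp add: emeasure_distr vimage)
  also have "\<dots> = (\<Prod>b\<in>Basis. (exchange j u - exchange j l) \<bullet> b)"
    using le by (intro emeasure_lborel_box) (simp add: inner_exchange exchange_Basis)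
  also have "(\<Prod>b\<in>Basis. (exchange j u - exchange j l) \<bullet> b) = (\<Prod>b\<in>Basis. (u - l) \<bullet> exchange j b)"
    by (simp add: inner_diff_left inner_exchange)
  also have "\<dots> = (\<Prod>b\<in>Basis. (u - l) \<bullet> b)"
    by (rule prod.reindex_bij_betw[OF bij_betw_exchange_Basis])
  finally show "emeasure (distr lborel lborel (exchange j)) (box l u) = (\<Prod>b\<in>Basis. (u - l) \<bullet> b)" .
qed simp

definition box_of :: "('n \<Rightarrow> complex set) \<Rightarrow> (complex ^ 'n) set" where
  "box_of D = {z. \<forall>j. z $ j \<in> D j}"

lemma open_box_of:
  fixes D :: "'n::finite \<Rightarrow> complex set"
  assumes "\<And>j. open (D j)"
  shows "open (box_of D)"
proof -
  have "box_of D = (\<Inter>j. (\<lambda>z. z $ j) -` D j)"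
    by (auto simp: box_of_def)
  moreover have "open ((\<lambda>z :: complex ^ 'n. z $ j) -` D j)" for j
    by (intro open_vimage assms continuous_intros)
  ultimately show ?thesis by (auto intro: open_INT)
qed

abbreviation box_pair :: "('n::finite \<Rightarrow> complex set) \<Rightarrow> 'n \<Rightarrow> ((complex ^ 'n) \<times> complex) measure" where
  "box_pair D j \<equiv> restrict_space lborel (box_of D) \<Otimes>\<^sub>M restrict_space lborel (D j)"

text \<open>The two swapped coordinates both range over \<open>D j\<close>, so
  \<open>box_of D \<times> D j\<close> is invariant and the invariance of Lebesgue measure restricts
  to it.\<close>

lemma
  assumes D: "\<And>j. open (D j)"
  shows measurable_exchange_box_pair: "exchange j \<in> box_pair D j \<rightarrow>\<^sub>M box_pair D j"
    and distr_exchange_box_pair: "distr (box_pair D j) (box_pair D j) (exchange j) = box_pair D j"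
proof -
  have P: "box_pair D j = restrict_space lborel (box_of D \<times> D j)"
    using D open_box_of[of D, OF D]
    by (subst pair_measure_restrict_space) (auto simp: lborel_prod lborel.sigma_finite_measure_axioms)
  have "box_of D \<times> D j \<in> sets lborel"
    using open_Times[OF open_box_of[of D, OF D] D] by simp
  moreover have "exchange j p \<in> box_of D \<times> D j \<longleftrightarrow> p \<in> box_of D \<times> D j" for p
    by (cases p) (auto simp: exchange_def box_of_def split: if_splits)
  ultimately show "exchange j \<in> box_pair D j \<rightarrow>\<^sub>M box_pair D j"
    "distr (box_pair D j) (box_pair D j) (exchange j) = box_pair D j"
    unfolding P by (intro distr_restrict_space_invariant distr_lborel_exchange; simp)+
qed

section \<open>Quadrature functionals acting on one coordinate\<close>

lemma sep_holomorphic_higher_partial_deriv: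
  fixes f :: "complex ^ 'n::finite \<Rightarrow> complex"
  assumes "sep_holomorphic f \<Omega>" "open \<Omega>"
  shows "sep_holomorphic ((partial_deriv j ^^ k) f) \<Omega>"
  by (induction k) (simp_all add: assms sep_holomorphic_partial_deriv)

lemma sep_holomorphic_foldr_partial_deriv:
  fixes f :: "complex ^ 'n::finite \<Rightarrow> complex"
  assumes "sep_holomorphic f \<Omega>" "open \<Omega>"
  shows "sep_holomorphic (foldr (\<lambda>j. partial_deriv j ^^ \<alpha> j) js f) \<Omega>"
  by (induction js) (simp_all add: assms sep_holomorphic_higher_partial_deriv)

lemma partial_deriv_cong_open:
  fixes f g :: "complex ^ 'n::finite \<Rightarrow> complex"
  assumes \<Omega>: "open \<Omega>" and z: "z \<in> \<Omega>" and eq: "\<And>z. z \<in> \<Omega> \<Longrightarrow> f z = g z"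
  shows "partial_deriv j f z = partial_deriv j g z"
  unfolding partial_deriv_coord_upd
proof (rule deriv_cong_ev[OF _ refl])
  have "\<forall>\<^sub>F w in nhds (z $ j). w \<in> {w. coord_upd z j w \<in> \<Omega>}"
    using z by (intro eventually_nhds_in_open open_slice \<Omega>) simp
  then show "\<forall>\<^sub>F w in nhds (z $ j). f (coord_upd z j w) = g (coord_upd z j w)"
    by eventually_elim (simp add: eq)
qed

lemma partial_deriv_linear_combination:
  fixes f :: "'s \<Rightarrow> complex ^ 'n::finite \<Rightarrow> complex"
  assumes f: "\<And>s. s \<in> S \<Longrightarrow> sep_holomorphic (f s) \<Omega>" and \<Omega>: "open \<Omega>" and z: "z \<in> \<Omega>"
  shows "partial_deriv j (\<lambda>z. \<Sum>s\<in>S. c s * f s z) z = (\<Sum>s\<in>S. c s * partial_deriv j (f s) z)"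
proof -
  have "((\<lambda>w. f s (coord_upd z j w)) has_field_derivative partial_deriv j (f s) z) (at (z $ j))"
    if "s \<in> S" for s
    unfolding partial_deriv_coord_upd
    by (rule holomorphic_derivI[OF sep_holomorphicD(2)[OF f[OF that] z] open_slice[OF \<Omega>]]) (simp add: z)
  then have "((\<lambda>w. \<Sum>s\<in>S. c s * f s (coord_upd z j w)) has_field_derivative
      (\<Sum>s\<in>S. c s * partial_deriv j (f s) z)) (at (z $ j))"
    by (intro DERIV_sum DERIV_cmult)
  then show ?thesis
    unfolding partial_deriv_coord_upd[of j "\<lambda>z. \<Sum>s\<in>S. c s * f s z"] by (rule DERIV_imp_deriv)
qed

text \<open>The formula for \<open>g\<close> is assumed on \<open>\<Omega>\<close> only, because the
  expansion of an inner fold is known only on the box. Openness makes this enough, as derivatives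
  are local.\<close>

lemma higher_partial_deriv_linear_combination:
  fixes f :: "'s \<Rightarrow> complex ^ 'n::finite \<Rightarrow> complex"
  assumes f: "\<And>s. s \<in> S \<Longrightarrow> sep_holomorphic (f s) \<Omega>" and \<Omega>: "open \<Omega>" and z: "z \<in> \<Omega>"
    and g: "\<And>z. z \<in> \<Omega> \<Longrightarrow> g z = (\<Sum>s\<in>S. c s * f s z)"
  shows "(partial_deriv j ^^ k) g z = (\<Sum>s\<in>S. c s * (partial_deriv j ^^ k) (f s) z)"
  using z
proof (induction k arbitrary: z)
  case 0
  then show ?case by (simp add: g)
next
  case (Suc k)
  have "(partial_deriv j ^^ Suc k) g z
      = partial_deriv j (\<lambda>z. \<Sum>s\<in>S. c s * (partial_deriv j ^^ k) (f s) z) z"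
    unfolding funpow.simps o_apply by (rule partial_deriv_cong_open[OF \<Omega> Suc.prems Suc.IH])
  also have "\<dots> = (\<Sum>s\<in>S. c s * (partial_deriv j ^^ Suc k) (f s) z)"
    unfolding funpow.simps o_apply
    by (intro partial_deriv_linear_combination[OF _ \<Omega> Suc.prems] sep_holomorphic_higher_partial_deriv f \<Omega>)
  finally show ?case .
qed

section \<open>Freezing coordinates and iterating the one-coordinate functionals\<close>

definition freeze :: "'n set \<Rightarrow> ('n \<Rightarrow> complex) \<Rightarrow> complex ^ 'n \<Rightarrow> complex ^ 'n" where
  "freeze J a z = (\<chi> i. if i \<in> J then a i else z $ i)"

lemma freeze_nth [simp]: "freeze J a z $ i = (if i \<in> J then a i else z $ i)"
  by (simp add: freeze_def)

lemma freeze_empty [simp]: "freeze {} a z = z"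
  by (simp add: vec_eq_iff)

lemma freeze_coord_upd: "i \<notin> J \<Longrightarrow> freeze J a (coord_upd z i w) = coord_upd (freeze J a z) i w"
  by (auto simp: vec_eq_iff)

lemma freeze_coord_upd_frozen: "i \<in> J \<Longrightarrow> freeze J a (coord_upd z i w) = freeze J a z"
  by (auto simp: vec_eq_iff)

lemma coord_upd_eq_freeze: "coord_upd z j w = freeze {j} (\<lambda>_. w) z"
  by (auto simp: vec_eq_iff)

lemma continuous_on_freeze: "continuous_on S (freeze J a :: complex ^ 'n::finite \<Rightarrow> _)"
  unfolding freeze_def
proof (rule continuous_on_vec_lambda)
  show "continuous_on S (\<lambda>z :: complex ^ 'n. if i \<in> J then a i else z $ i)" for i
    by (cases "i \<in> J") (auto intro: continuous_intros)
qed

lemma sep_holomorphic_freeze: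
  fixes f :: "complex ^ 'n::finite \<Rightarrow> complex"
  assumes f: "sep_holomorphic f \<Omega>" and \<Omega>: "\<And>z. z \<in> \<Omega> \<Longrightarrow> freeze J a z \<in> \<Omega>"
  shows "sep_holomorphic (\<lambda>z. f (freeze J a z)) \<Omega>"
  unfolding sep_holomorphic_def
proof (intro conjI ballI allI)
  show "continuous_on \<Omega> (\<lambda>z. f (freeze J a z))"
    by (rule continuous_on_compose2[OF sep_holomorphicD(1)[OF f] continuous_on_freeze]) (auto intro: \<Omega>)
next
  fix z i assume z: "z \<in> \<Omega>"
  show "(\<lambda>w. f (freeze J a (coord_upd z i w))) holomorphic_on {w. coord_upd z i w \<in> \<Omega>}"
  proof (cases "i \<in> J")
    case False
    have "{w. coord_upd z i w \<in> \<Omega>} \<subseteq> {w. coord_upd (freeze J a z) i w \<in> \<Omega>}"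
      using \<Omega> freeze_coord_upd[OF False, of a z] by force
    with sep_holomorphicD(2)[OF f \<Omega>[OF z], of i] show ?thesis
      using False by (auto simp: freeze_coord_upd intro: holomorphic_on_subset)
  qed (simp add: freeze_coord_upd_frozen)
qed

lemma higher_partial_deriv_freeze:
  assumes "j \<notin> J"
  shows "(partial_deriv j ^^ k) (\<lambda>z. f (freeze J a z)) = (\<lambda>z. (partial_deriv j ^^ k) f (freeze J a z))"
  by (induction k) (use assms in \<open>simp_all add: partial_deriv_coord_upd freeze_coord_upd\<close>)

text \<open>The value is kept as a function on all of \<open>complex ^ 'n\<close>, constant in the
  coordinate \<open>j\<close>, so that functionals for different coordinates compose on one
  box.\<close>

definition coord_functional ::
    "'n \<Rightarrow> (complex \<times> nat) set \<Rightarrow> (complex \<Rightarrow> nat \<Rightarrow> complex) \<Rightarrow>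
      (complex ^ 'n \<Rightarrow> complex) \<Rightarrow> complex ^ 'n \<Rightarrow> complex" where
  "coord_functional j S c f z = (\<Sum>(a, k)\<in>S. c a k * (partial_deriv j ^^ k) f (coord_upd z j a))"

lemma freeze_in_box_of: "z \<in> box_of D \<Longrightarrow> (\<And>j. j \<in> J \<Longrightarrow> a j \<in> D j) \<Longrightarrow> freeze J a z \<in> box_of D"
  by (auto simp: box_of_def)

lemma coord_upd_in_box_of: "z \<in> box_of D \<Longrightarrow> coord_upd z j w \<in> box_of D \<longleftrightarrow> w \<in> D j"
  by (auto simp: box_of_def)

lemma sep_holomorphic_coord_functional:
  fixes f :: "complex ^ 'n::finite \<Rightarrow> complex"
  assumes D: "\<And>j. open (D j)" and f: "sep_holomorphic f (box_of D)" and S: "S \<subseteq> D j \<times> UNIV"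
  shows "sep_holomorphic (coord_functional j S c f) (box_of D)"
  unfolding coord_functional_def[abs_def] case_prod_unfold
proof (intro sep_holomorphic_sum sep_holomorphic_cmult)
  fix s assume "s \<in> S"
  with S show "sep_holomorphic (\<lambda>z. (partial_deriv j ^^ snd s) f (coord_upd z j (fst s))) (box_of D)"
    unfolding coord_upd_eq_freeze
    by (intro sep_holomorphic_freeze sep_holomorphic_higher_partial_deriv f open_box_of D freeze_in_box_of) auto
qed

text \<open>A product of sums is expanded: \<open>p\<close> picks one pair of node and order for
  every processed coordinate. Distinctness of \<open>js\<close> matters because the outer functional
  differentiates in a coordinate that is not yet frozen, so it commutes with the freezing done by
  the inner ones.\<close>

lemma foldr_coord_functional:
  fixes f :: "complex ^ 'n::finite \<Rightarrow> complex"
  assumes D: "\<And>j. open (D j)" and f: "sep_holomorphic f (box_of D)"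
    and S: "\<And>j. finite (S j)" "\<And>j. S j \<subseteq> D j \<times> UNIV"
    and js: "distinct js" and z: "z \<in> box_of D"
  shows "foldr (\<lambda>j. coord_functional j (S j) (c j)) js f z =
    (\<Sum>p\<in>PiE (set js) S. (\<Prod>j\<in>set js. c j (fst (p j)) (snd (p j))) *
        foldr (\<lambda>j. partial_deriv j ^^ snd (p j)) js f (freeze (set js) (\<lambda>j. fst (p j)) z))"
  using js z
proof (induction js arbitrary: z)
  case Nil
  then show ?case by simp
next
  case (Cons j js)
  let ?J = "set js"
  define C where "C p = (\<Prod>j\<in>?J. c j (fst (p j)) (snd (p j)))" for p
  define F where "F p = foldr (\<lambda>j. partial_deriv j ^^ snd (p j)) js f" for p :: "'n \<Rightarrow> complex \<times> nat"
  have j: "j \<notin> ?J" "distinct js"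
    using Cons.prems by auto
  have in_D: "fst (p i) \<in> D i" if "p \<in> PiE ?J S" "i \<in> ?J" for p i
    using PiE_mem[OF that] S(2)[of i] by auto
  have sepF: "sep_holomorphic (\<lambda>z. F p (freeze ?J (\<lambda>i. fst (p i)) z)) (box_of D)"
    if p: "p \<in> PiE ?J S" for p
    unfolding F_def
    by (intro sep_holomorphic_freeze sep_holomorphic_foldr_partial_deriv f open_box_of D freeze_in_box_of in_D[OF p])
  define G where "G = foldr (\<lambda>j. coord_functional j (S j) (c j)) js f"
  have G: "(partial_deriv j ^^ k) G z = (\<Sum>p\<in>PiE ?J S. C p *
      (partial_deriv j ^^ k) (F p) (freeze ?J (\<lambda>i. fst (p i)) z))" if z: "z \<in> box_of D" for k z
  proof -
    have "(partial_deriv j ^^ k) G z = (\<Sum>p\<in>PiE ?J S. C p *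
      (partial_deriv j ^^ k) (\<lambda>z. F p (freeze ?J (\<lambda>i. fst (p i)) z)) z)"
      using Cons.IH[OF j(2)] by (intro higher_partial_deriv_linear_combination[OF sepF open_box_of[OF D] z])
        (auto simp: G_def C_def F_def)
    then show ?thesis
      using j(1) by (simp add: higher_partial_deriv_freeze)
  qed
  have "foldr (\<lambda>j. coord_functional j (S j) (c j)) (j # js) f z
      = (\<Sum>s\<in>S j. c j (fst s) (snd s) * (partial_deriv j ^^ snd s) G (coord_upd z j (fst s)))"
    by (simp add: G_def coord_functional_def case_prod_unfold)
  also have "\<dots> = (\<Sum>s\<in>S j. \<Sum>p\<in>PiE ?J S. c j (fst s) (snd s) * (C p *
      (partial_deriv j ^^ snd s) (F p) (freeze ?J (\<lambda>i. fst (p i)) (coord_upd z j (fst s)))))"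
  proof (rule sum.cong[OF refl])
    fix s assume "s \<in> S j"
    with S(2)[of j] Cons.prems have "coord_upd z j (fst s) \<in> box_of D"
      by (auto simp: coord_upd_in_box_of)
    then show "c j (fst s) (snd s) * (partial_deriv j ^^ snd s) G (coord_upd z j (fst s))
      = (\<Sum>p\<in>PiE ?J S. c j (fst s) (snd s) * (C p *
      (partial_deriv j ^^ snd s) (F p) (freeze ?J (\<lambda>i. fst (p i)) (coord_upd z j (fst s)))))"
      by (simp add: G sum_distrib_left)
  qed
  also have "\<dots> = (\<Sum>(s, p)\<in>S j \<times> PiE ?J S. c j (fst s) (snd s) * (C p *
      (partial_deriv j ^^ snd s) (F p) (freeze ?J (\<lambda>i. fst (p i)) (coord_upd z j (fst s)))))"
    by (rule sum.cartesian_product)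
  \<comment> \<open>Every term is written as a function of \<open>p(j := s)\<close> alone, in
    preparation for the reindexing. As \<open>j\<close> is not in \<open>?J\<close>, the update
    leaves all factors belonging to \<open>js\<close> unchanged.\<close>
  also have "\<dots> = (\<Sum>(s, p)\<in>S j \<times> PiE ?J S. (\<lambda>p. (\<Prod>j\<in>set (j # js). c j (fst (p j)) (snd (p j))) *
        foldr (\<lambda>j. partial_deriv j ^^ snd (p j)) (j # js) f (freeze (set (j # js)) (\<lambda>j. fst (p j)) z)) (p(j := s)))"
  proof (intro sum.cong refl, clarsimp simp del: fun_upd_apply)
    fix a k and p :: "'n \<Rightarrow> complex \<times> nat"
    let ?p = "p(j := (a, k))"
    have [simp]: "?p i = p i" if "i \<in> ?J" for i
      using that j(1) by auto
    have 1: "C p = (\<Prod>i\<in>?J. c i (fst (?p i)) (snd (?p i)))"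
      unfolding C_def using j(1) by (intro prod.cong) auto
    have 2: "F p = foldr (\<lambda>i. partial_deriv i ^^ snd (?p i)) js f"
      unfolding F_def using j(1) by (intro foldr_cong) auto
    have 3: "freeze ?J (\<lambda>i. fst (p i)) (coord_upd z j a) = freeze (insert j ?J) (\<lambda>i. fst (?p i)) z"
      using j(1) by (auto simp: vec_eq_iff)
    show "c j a k * (C p * (partial_deriv j ^^ k) (F p) (freeze ?J (\<lambda>i. fst (p i)) (coord_upd z j a))) =
       (\<Prod>i\<in>insert j ?J. c i (fst (?p i)) (snd (?p i))) *
       (partial_deriv j ^^ snd (?p j)) (foldr (\<lambda>i. partial_deriv i ^^ snd (?p i)) js f)
         (freeze (insert j ?J) (\<lambda>i. fst (?p i)) z)"
      unfolding 3 using j(1) by (simp add: 1 2 del: fun_upd_apply) (simp add: mult.assoc)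
  qed
  also have "\<dots> = (\<Sum>p\<in>(\<lambda>(s, p). p(j := s)) ` (S j \<times> PiE ?J S). (\<Prod>j\<in>set (j # js). c j (fst (p j)) (snd (p j))) *
        foldr (\<lambda>j. partial_deriv j ^^ snd (p j)) (j # js) f (freeze (set (j # js)) (\<lambda>j. fst (p j)) z))"
    by (subst sum.reindex[OF inj_combinator[OF j(1)]]) (simp add: case_prod_unfold o_def)
  also have "(\<lambda>(s, p). p(j := s)) ` (S j \<times> PiE ?J S) = PiE (set (j # js)) S"
    by (simp add: PiE_insert_eq)
  finally show ?case .
qed

section \<open>Borel versus Lebesgue measure, and square integrability for finite measures\<close>

lemma borel_measurable_restrict_lborel:
  fixes f :: "'a::euclidean_space \<Rightarrow> 'b::topological_space"
  assumes "continuous_on U f"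
  shows "f \<in> borel_measurable (restrict_space lborel U)"
proof -
  have "sets (restrict_space lborel U) = sets (restrict_space borel U)"
    by (rule sets_restrict_space_cong) simp
  then show ?thesis
    using borel_measurable_continuous_on_restrict[OF assms] measurable_cong_sets[OF _ refl] by blast
qed

text \<open>The Bergman spaces are defined with the completed measure, whereas Fubini works with
  products of Borel measures. Completion does not affect integrability of Borel functions.\<close>

lemma integrable_lebesgue_on_iff:
  fixes f :: "'a::euclidean_space \<Rightarrow> 'b::{banach, second_countable_topology}"
  assumes U: "open U" and f: "f \<in> borel_measurable (restrict_space lborel U)"
  shows "integrable (lebesgue_on U) f \<longleftrightarrow> integrable (restrict_space lborel U) f"
proof -
  have "(\<lambda>x. indicator U x *\<^sub>R f x) \<in> borel_measurable lborel"
    using f U by (subst borel_measurable_restrict_space_iff[symmetric]) auto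
  then show ?thesis
    using U by (simp add: integrable_restrict_space integrable_completion)
qed

lemma has_bochner_integral_lebesgue_on_iff:
  fixes f :: "'a::euclidean_space \<Rightarrow> 'b::{banach, second_countable_topology}"
  assumes U: "open U" and f: "f \<in> borel_measurable (restrict_space lborel U)"
  shows "has_bochner_integral (lebesgue_on U) f x \<longleftrightarrow> has_bochner_integral (restrict_space lborel U) f x"
proof -
  have "(\<lambda>x. indicator U x *\<^sub>R f x) \<in> borel_measurable lborel"
    using f U by (subst borel_measurable_restrict_space_iff[symmetric]) auto
  then show ?thesis
    using U by (simp add: has_bochner_integral_iff integrable_restrict_space integral_restrict_space
        integrable_completion integral_completion)
qed

text \<open>Cauchy-Schwarz for the norm of \<open>g\<close> against the constant 1, whose square
  integrates to the total mass.\<close>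

lemma (in finite_measure) norm_integral_square_le:
  fixes g :: "'a \<Rightarrow> 'b::{banach, second_countable_topology}"
  assumes g: "integrable M g" and g2: "integrable M (\<lambda>x. (norm (g x))\<^sup>2)"
  shows "(norm (integral\<^sup>L M g))\<^sup>2 \<le> measure M (space M) * (\<integral>x. (norm (g x))\<^sup>2 \<partial>M)"
proof -
  define I where "I = (\<integral>x. norm (g x) \<partial>M)"
  have [measurable]: "g \<in> borel_measurable M"
    using g by auto
  have "(\<integral>\<^sup>+x. ennreal (norm (g x)) * 1 \<partial>M)\<^sup>2
      \<le> (\<integral>\<^sup>+x. (ennreal (norm (g x)))\<^sup>2 \<partial>M) * (\<integral>\<^sup>+x. 1\<^sup>2 \<partial>M)"
    by (rule Cauchy_Schwarz_nn_integral) auto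
  also have "(\<integral>\<^sup>+x. ennreal (norm (g x)) * 1 \<partial>M) = ennreal I"
    unfolding I_def using g by (simp add: nn_integral_eq_integral)
  also have "(\<integral>\<^sup>+x. (ennreal (norm (g x)))\<^sup>2 \<partial>M) = ennreal (\<integral>x. (norm (g x))\<^sup>2 \<partial>M)"
    using g2 by (simp add: nn_integral_eq_integral ennreal_power)
  also have "(\<integral>\<^sup>+x. 1\<^sup>2 \<partial>M) = ennreal (measure M (space M))"
    by (simp add: emeasure_eq_measure)
  finally have "I\<^sup>2 \<le> (\<integral>x. (norm (g x))\<^sup>2 \<partial>M) * measure M (space M)"
    by (simp add: I_def ennreal_power ennreal_mult'[symmetric])
  moreover have "norm (integral\<^sup>L M g) \<le> I"
    unfolding I_def by (rule integral_norm_bound)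
  then have "(norm (integral\<^sup>L M g))\<^sup>2 \<le> I\<^sup>2"
    by (intro power_mono) auto
  ultimately show ?thesis
    by (simp add: mult.commute)
qed

lemma (in finite_measure) integrable_if_norm_square:
  fixes f :: "'a \<Rightarrow> complex"
  assumes f: "f \<in> borel_measurable M" and f2: "integrable M (\<lambda>z. (cmod (f z))\<^sup>2)"
  shows "integrable M f"
proof (rule square_integrable_imp_integrable[OF f])
  show "integrable M (\<lambda>z. f z ^ 2)"
    using f by (intro Bochner_Integration.integrable_bound[OF f2]) (auto simp: norm_power)
qed

lemma higher_deriv_coord_upd:
  "(deriv ^^ k) (\<lambda>w. f (coord_upd z j w)) = (\<lambda>w. (partial_deriv j ^^ k) f (coord_upd z j w))"
  by (induction k) (simp_all add: partial_deriv_coord_upd)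

lemma finite_measure_restrict_lborel:
  fixes U :: "'a::euclidean_space set"
  assumes "open U" "emeasure lborel U < \<infinity>"
  shows "finite_measure (restrict_space lborel U)"
  using assms by (intro finite_measureI) (simp add: space_restrict_space emeasure_restrict_space)

lemma measure_restrict_lborel:
  fixes U :: "'a::euclidean_space set"
  assumes "open U"
  shows "measure (restrict_space lborel U) U = measure lborel U"
  using assms by (simp add: measure_restrict_space)

lemma measure_lborel_pos:
  fixes U :: "'a::euclidean_space set"
  assumes "open U" "U \<noteq> {}" "emeasure lborel U < \<infinity>"
  shows "0 < measure lborel U"
proof -
  have "emeasure lborel U \<noteq> 0"
    using assms open_not_negligible[of U] by (simp add: negligible_iff_null_sets null_sets_def)
  with assms(3) show ?thesis
    by (simp add: measure_def enn2real_positive_iff zero_less_iff_neq_zero)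
qed

section \<open>Products of domains of finite area\<close>

locale finite_domains =
  fixes D :: "'n::finite \<Rightarrow> complex set"
  assumes domain: "\<And>j. is_domain (D j)"
    and finite_area: "\<And>j. emeasure lborel (D j) < \<infinity>"
    and finite_volume: "emeasure lborel (box_of D) < \<infinity>"
begin

lemma open_D: "open (D j)" and D_nonempty: "D j \<noteq> {}" and connected_D: "connected (D j)"
  using domain[of j] by (auto simp: is_domain_def)

lemma open_box: "open (box_of D)"
  by (rule open_box_of[OF open_D])

lemma box_nonempty: "box_of D \<noteq> {}"
proof -
  have "(\<chi> j. SOME w. w \<in> D j) \<in> box_of D"
    using D_nonempty by (simp add: box_of_def some_in_eq)
  then show ?thesis by blast
qed

text \<open>Open connected sets are path connected, and paths in the factors can be run
  simultaneously.\<close>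

lemma is_domain_box: "is_domain (box_of D)"
proof -
  have "path_connected (box_of D)"
    unfolding path_connected_def
  proof (intro ballI)
    fix x y assume xy: "x \<in> box_of D" "y \<in> box_of D"
    have "\<exists>g. path g \<and> path_image g \<subseteq> D j \<and> pathstart g = x $ j \<and> pathfinish g = y $ j" for j
      using xy connected_open_path_connected[OF open_D connected_D, of j]
      by (auto simp: path_connected_def box_of_def)
    then obtain g where g: "\<And>j. path (g j)" "\<And>j. path_image (g j) \<subseteq> D j"
      "\<And>j. pathstart (g j) = x $ j" "\<And>j. pathfinish (g j) = y $ j"
      by metis
    define h where "h t = (\<chi> j. g j t)" for t
    have "path h"
      using g(1) unfolding path_def h_def by (intro continuous_on_vec_lambda)
    moreover have "path_image h \<subseteq> box_of D"
      using g(2) by (auto simp: path_image_def box_of_def h_def image_subset_iff)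
    moreover have "pathstart h = x" "pathfinish h = y"
      using g(3,4) by (auto simp: pathstart_def pathfinish_def h_def vec_eq_iff)
    ultimately show "\<exists>g. path g \<and> path_image g \<subseteq> box_of D \<and> pathstart g = x \<and> pathfinish g = y"
      by blast
  qed
  then show ?thesis
    using open_box box_nonempty by (simp add: is_domain_def path_connected_imp_connected)
qed

abbreviation "M \<equiv> restrict_space lborel (box_of D)"
abbreviation "N j \<equiv> restrict_space lborel (D j)"
abbreviation "area j \<equiv> measure lborel (D j)"
abbreviation "vol \<equiv> measure lborel (box_of D)"

lemma area_pos: "0 < area j"
  by (rule measure_lborel_pos[OF open_D D_nonempty finite_area])

lemma volume_pos: "0 < vol"
  by (rule measure_lborel_pos[OF open_box box_nonempty finite_volume])

sublocale M: finite_measure M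
  by (rule finite_measure_restrict_lborel[OF open_box finite_volume])

sublocale N: finite_measure "N j" for j
  by (rule finite_measure_restrict_lborel[OF open_D finite_area])

sublocale MN: pair_sigma_finite M "N j" for j ..

lemma has_bochner_integral_exchange:
  fixes h :: "(complex ^ 'n) \<times> complex \<Rightarrow> 'b::{banach, second_countable_topology}"
  assumes "has_bochner_integral (M \<Otimes>\<^sub>M N j) h x"
  shows "has_bochner_integral (M \<Otimes>\<^sub>M N j) (\<lambda>p. h (exchange j p)) x"
proof -
  have T: "exchange j \<in> M \<Otimes>\<^sub>M N j \<rightarrow>\<^sub>M M \<Otimes>\<^sub>M N j"
    by (rule measurable_exchange_box_pair[OF open_D])
  have h: "integrable (M \<Otimes>\<^sub>M N j) h" "integral\<^sup>L (M \<Otimes>\<^sub>M N j) h = x"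
    using assms by (auto simp: has_bochner_integral_iff)
  have "integrable (M \<Otimes>\<^sub>M N j) (\<lambda>p. h (exchange j p))"
    using T by (rule integrable_distr) (simp only: distr_exchange_box_pair[of D, OF open_D] h)
  moreover have "(\<integral>p. h (exchange j p) \<partial>(M \<Otimes>\<^sub>M N j)) = x"
    using integral_distr[OF T borel_measurable_integrable[OF h(1)]]
    unfolding distr_exchange_box_pair[of D, OF open_D] h(2) by simp
  ultimately show ?thesis
    by (simp add: has_bochner_integral_iff)
qed

text \<open>After \<open>exchange\<close> the integrand is \<open>h (fst p)\<close>; the replaced
  coordinate has become the idle variable and integrates to \<open>area j\<close>.\<close>

lemma has_bochner_integral_coord_upd:
  fixes h :: "complex ^ 'n \<Rightarrow> 'b::{banach, second_countable_topology}"
  assumes "has_bochner_integral M h x"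
  shows "has_bochner_integral (M \<Otimes>\<^sub>M N j) (\<lambda>p. h (coord_upd (fst p) j (snd p))) (area j *\<^sub>R x)"
  using has_bochner_integral_exchange[OF has_bochner_integral_pair_fst[OF
        M.sigma_finite_measure_axioms N.finite_measure_axioms assms, of j]]
  by (simp add: exchange_def measure_restrict_lborel space_restrict_space open_D)

text \<open>The integral of \<open>h (z $ j)\<close> over the box with an idle variable is computed
  twice: exchanging the variables gives \<open>vol\<close> times \<open>x\<close>, and integrating
  out the idle variable gives \<open>area j\<close> times the integral sought.\<close>

lemma has_bochner_integral_component:
  fixes h :: "complex \<Rightarrow> 'b::{banach, second_countable_topology}"
  assumes h: "has_bochner_integral (N j) h x"
  shows "has_bochner_integral M (\<lambda>z. h (z $ j)) ((vol / area j) *\<^sub>R x)"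
proof -
  have *: "has_bochner_integral (M \<Otimes>\<^sub>M N j) (\<lambda>p. h (fst p $ j)) (vol *\<^sub>R x)"
    using has_bochner_integral_exchange[OF has_bochner_integral_pair_snd[OF
        M.finite_measure_axioms N.sigma_finite_measure_axioms h]]
    by (simp add: exchange_def measure_restrict_lborel space_restrict_space open_box)
  \<comment> \<open>Integrability on the box is not known beforehand. It is read off from Fubini,
    since the inner integrand is constant in \<open>w\<close> and the nonzero factor
    \<open>area j\<close> can be divided out.\<close>
  then have "integrable M (\<lambda>z. \<integral>w. h (fst (z, w) $ j) \<partial>N j)"
    by (intro MN.integrable_fst') (auto simp: has_bochner_integral_iff)
  then have int: "integrable M (\<lambda>z. area j *\<^sub>R h (z $ j))"
    by (simp add: measure_restrict_lborel space_restrict_space open_D)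
  have "integrable M (\<lambda>z. (1 / area j) *\<^sub>R area j *\<^sub>R h (z $ j))"
    by (rule integrable_scaleR_right) (rule int)
  moreover have "(1 / area j) *\<^sub>R area j *\<^sub>R y = y" for y :: 'b
    using area_pos[of j] by simp
  ultimately have "integrable M (\<lambda>z. h (z $ j))"
    by (simp only:)
  then have hM: "has_bochner_integral M (\<lambda>z. h (z $ j)) (\<integral>z. h (z $ j) \<partial>M)"
    by (rule has_bochner_integral_integrable)
  have "area j *\<^sub>R (\<integral>z. h (z $ j) \<partial>M) = vol *\<^sub>R x"
    using has_bochner_integral_eq[OF has_bochner_integral_pair_fst[OF
        M.sigma_finite_measure_axioms N.finite_measure_axioms hM] *]
    by (simp add: measure_restrict_lborel space_restrict_space open_D)
  then have "(1 / area j) *\<^sub>R area j *\<^sub>R (\<integral>z. h (z $ j) \<partial>M) = (1 / area j) *\<^sub>R vol *\<^sub>R x"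
    by simp
  then have "(\<integral>z. h (z $ j) \<partial>M) = (vol / area j) *\<^sub>R x"
    using area_pos[of j] by simp
  with hM show ?thesis by simp
qed

lemma bergman_iff:
  "f \<in> bergman (box_of D) \<longleftrightarrow>
    holomorphic_several f (box_of D) \<and> integrable M (\<lambda>z. (cmod (f z))\<^sup>2)"
proof -
  have "integrable (lebesgue_on (box_of D)) (\<lambda>z. (cmod (f z))\<^sup>2) \<longleftrightarrow> integrable M (\<lambda>z. (cmod (f z))\<^sup>2)"
    if "holomorphic_several f (box_of D)"
    using sep_holomorphicD(1)[OF holomorphic_several_imp_sep_holomorphic[OF that]]
    by (intro integrable_lebesgue_on_iff open_box borel_measurable_restrict_lborel continuous_intros)
  then show ?thesis
    by (auto simp: bergman_def)
qed

lemma bergman1_iff: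
  "f \<in> bergman1 (D j) \<longleftrightarrow> f holomorphic_on D j \<and> integrable (N j) (\<lambda>z. (cmod (f z))\<^sup>2)"
proof -
  have "integrable (lebesgue_on (D j)) (\<lambda>z. (cmod (f z))\<^sup>2) \<longleftrightarrow> integrable (N j) (\<lambda>z. (cmod (f z))\<^sup>2)"
    if "f holomorphic_on D j"
    using holomorphic_on_imp_continuous_on[OF that]
    by (intro integrable_lebesgue_on_iff open_D borel_measurable_restrict_lborel continuous_intros)
  then show ?thesis
    by (auto simp: bergman1_def)
qed

lemma has_bochner_integral_box_iff:
  fixes f :: "complex ^ 'n \<Rightarrow> complex"
  assumes "continuous_on (box_of D) f"
  shows "has_bochner_integral (lebesgue_on (box_of D)) f x \<longleftrightarrow> has_bochner_integral M f x"
  by (intro has_bochner_integral_lebesgue_on_iff open_box borel_measurable_restrict_lborel assms)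

lemma has_bochner_integral_D_iff:
  fixes f :: "complex \<Rightarrow> complex"
  assumes "continuous_on (D j) f"
  shows "has_bochner_integral (lebesgue_on (D j)) f x \<longleftrightarrow> has_bochner_integral (N j) f x"
  by (intro has_bochner_integral_lebesgue_on_iff open_D borel_measurable_restrict_lborel assms)

text \<open>By the quadrature identity the functional is, for almost every slice, the integral over
  \<open>D j\<close>. So its square integrability needs no pointwise bound on derivatives, only the
  Cauchy-Schwarz inequality.\<close>

lemma coord_functional_integral:
  fixes f :: "complex ^ 'n \<Rightarrow> complex"
  assumes f: "sep_holomorphic f (box_of D)" and f2: "integrable M (\<lambda>z. (cmod (f z))\<^sup>2)"
    and S: "S \<subseteq> D j \<times> UNIV"
    and quad: "\<And>g. g \<in> bergman1 (D j) \<Longrightarrow>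
      has_bochner_integral (lebesgue_on (D j)) g (\<Sum>(a, k)\<in>S. c a k * (deriv ^^ k) g a)"
  shows "integrable M (\<lambda>z. (cmod (coord_functional j S c f z))\<^sup>2)"
    and "has_bochner_integral M (coord_functional j S c f) (of_real (area j) * integral\<^sup>L M f)"
proof -
  let ?L = "coord_functional j S c f"
  have f_meas: "f \<in> borel_measurable M"
    by (intro borel_measurable_restrict_lborel sep_holomorphicD(1)[OF f])
  have L_meas [measurable]: "?L \<in> borel_measurable M"
    by (intro borel_measurable_restrict_lborel sep_holomorphicD(1)[OF sep_holomorphic_coord_functional] open_D f S)
  have f1: "integrable M f"
    by (rule M.integrable_if_norm_square[OF f_meas f2])
  have P: "has_bochner_integral (M \<Otimes>\<^sub>M N j) (\<lambda>p. f (coord_upd (fst p) j (snd p))) (area j *\<^sub>R integral\<^sup>L M f)"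
    by (rule has_bochner_integral_coord_upd[OF has_bochner_integral_integrable[OF f1]])
  then have int1: "integrable (M \<Otimes>\<^sub>M N j) (\<lambda>p. f (coord_upd (fst p) j (snd p)))"
    by (auto simp: has_bochner_integral_iff)
  have int2: "integrable (M \<Otimes>\<^sub>M N j) (\<lambda>p. (cmod (f (coord_upd (fst p) j (snd p))))\<^sup>2)"
    using has_bochner_integral_coord_upd[OF has_bochner_integral_integrable[OF f2], of j]
    by (auto simp: has_bochner_integral_iff)
  \<comment> \<open>Only almost everywhere: \<open>?L z\<close> is defined at every
    \<open>z\<close>, but the quadrature identity gives information only where the slice is square
    integrable.\<close>
  have eq: "AE z in M. z \<in> box_of D \<and> integrable (N j) (\<lambda>w. f (coord_upd z j w)) \<and>
      integrable (N j) (\<lambda>w. (cmod (f (coord_upd z j w)))\<^sup>2) \<and> (\<integral>w. f (coord_upd z j w) \<partial>N j) = ?L z"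
    using AE_space[of M] MN.AE_integrable_fst'[OF int1] MN.AE_integrable_fst'[OF int2]
  proof eventually_elim
    case (elim z)
    then have z: "z \<in> box_of D"
      by (simp add: space_restrict_space)
    let ?g = "\<lambda>w. f (coord_upd z j w)"
    have "?g holomorphic_on D j"
      using sep_holomorphicD(2)[OF f z, of j] by (simp add: coord_upd_in_box_of[OF z])
    moreover from this have "has_bochner_integral (lebesgue_on (D j)) ?g
        (\<Sum>(a, k)\<in>S. c a k * (deriv ^^ k) ?g a)"
      using elim by (intro quad) (simp add: bergman1_iff)
    ultimately have "has_bochner_integral (N j) ?g (?L z)"
      by (simp add: has_bochner_integral_D_iff holomorphic_on_imp_continuous_on
          higher_deriv_coord_upd coord_functional_def)
    with z elim show ?case
      by (simp add: has_bochner_integral_iff)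
  qed
  have meas1: "(\<lambda>z. \<integral>w. f (coord_upd z j w) \<partial>N j) \<in> borel_measurable M"
    and intg: "integrable M (\<lambda>z. \<integral>w. f (coord_upd z j w) \<partial>N j)"
    using MN.integrable_fst'[OF int1] by auto
  have "integrable M ?L"
    using intg by (rule integrable_cong_AE_imp) (use eq in \<open>auto elim: eventually_mono\<close>)
  moreover have "integral\<^sup>L M ?L = (\<integral>z. \<integral>w. f (coord_upd z j w) \<partial>N j \<partial>M)"
    using eq meas1 by (intro integral_cong_AE) (auto elim: eventually_mono)
  moreover have "(\<integral>z. \<integral>w. f (coord_upd z j w) \<partial>N j \<partial>M) = of_real (area j) * integral\<^sup>L M f"
    using MN.integral_fst'[OF int1] P by (simp add: has_bochner_integral_iff scaleR_conv_of_real)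
  ultimately show "has_bochner_integral M ?L (of_real (area j) * integral\<^sup>L M f)"
    by (simp add: has_bochner_integral_iff)
  \<comment> \<open>The Cauchy-Schwarz majorant, integrable in \<open>z\<close> by Fubini for the
    squared modulus on the extended box.\<close>
  have "integrable M (\<lambda>z. area j * (\<integral>w. (cmod (f (coord_upd z j w)))\<^sup>2 \<partial>N j))"
    using MN.integrable_fst'[OF int2] by simp
  then show "integrable M (\<lambda>z. (cmod (?L z))\<^sup>2)"
  proof (rule Bochner_Integration.integrable_bound)
    show "AE z in M. norm ((cmod (?L z))\<^sup>2) \<le> norm (area j * (\<integral>w. (cmod (f (coord_upd z j w)))\<^sup>2 \<partial>N j))"
      using eq
    proof eventually_elim
      case (elim z)
      then have "(cmod (?L z))\<^sup>2 \<le> area j * (\<integral>w. (cmod (f (coord_upd z j w)))\<^sup>2 \<partial>N j)"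
        using N.norm_integral_square_le[of j "\<lambda>w. f (coord_upd z j w)"]
        by (simp add: measure_restrict_lborel space_restrict_space open_D)
      then show ?case by simp
    qed
  qed auto
qed

text \<open>Holomorphy and square integrability travel with the induction because the next
  coordinate requires both. Each step multiplies the integral by \<open>area j\<close>, since the
  new function is constant in the coordinate just processed.\<close>

lemma foldr_coord_functional_integral:
  fixes f :: "complex ^ 'n \<Rightarrow> complex"
  assumes f: "sep_holomorphic f (box_of D)" "integrable M (\<lambda>z. (cmod (f z))\<^sup>2)"
    and S: "\<And>j. S j \<subseteq> D j \<times> UNIV"
    and quad: "\<And>j g. g \<in> bergman1 (D j) \<Longrightarrow>
      has_bochner_integral (lebesgue_on (D j)) g (\<Sum>(a, k)\<in>S j. c j a k * (deriv ^^ k) g a)"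
  defines "G js \<equiv> foldr (\<lambda>j. coord_functional j (S j) (c j)) js f"
  shows "sep_holomorphic (G js) (box_of D)" "integrable M (\<lambda>z. (cmod (G js z))\<^sup>2)"
    "integral\<^sup>L M (G js) = (\<Prod>j\<leftarrow>js. of_real (area j)) * integral\<^sup>L M f"
proof (induction js)
  case Nil
  { case 1 then show ?case using f by (simp add: G_def) }
  { case 2 then show ?case using f by (simp add: G_def) }
  { case 3 then show ?case by (simp add: G_def) }
next
  case (Cons j js)
  have G: "G (j # js) = coord_functional j (S j) (c j) (G js)"
    by (simp add: G_def)
  { case 1 show ?case unfolding G by (intro sep_holomorphic_coord_functional open_D Cons.IH S) }
  note step = coord_functional_integral[OF Cons.IH(1,2) S quad]
  { case 2 show ?case unfolding G by (rule step(1)) }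
  { case 3 show ?case
      unfolding G using step(2)[THEN has_bochner_integral_integral_eq] Cons.IH(3) by (simp add: mult.assoc) }
qed

lemma quadrature_domain_box:
  assumes "\<And>j. quadrature_domain1 (D j)"
  shows "quadrature_domain (box_of D)"
proof -
  define quad_data where "quad_data j S c \<longleftrightarrow> finite S \<and> S \<subseteq> D j \<times> UNIV \<and> (\<forall>g\<in>bergman1 (D j).
      has_bochner_integral (lebesgue_on (D j)) g (\<Sum>(a, k)\<in>S. c a k * (deriv ^^ k) g a))"
    for j and S :: "(complex \<times> nat) set" and c
  have "\<exists>S c. quad_data j S c" for j
    using assms[of j] by (simp add: quadrature_domain1_def quad_data_def)
  then obtain S c where "\<And>j. quad_data j (S j) (c j)"
    by metis
  then have S: "\<And>j. finite (S j)" "\<And>j. S j \<subseteq> D j \<times> UNIV"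
    and quad: "\<And>j g. g \<in> bergman1 (D j) \<Longrightarrow>
      has_bochner_integral (lebesgue_on (D j)) g (\<Sum>(a, k)\<in>S j. c j a k * (deriv ^^ k) g a)"
    unfolding quad_data_def by auto
  \<comment> \<open>Splits a choice of pairs into a point and a multi-index. Being injective, it
    allows the coefficient to be read off from the point and the multi-index.\<close>
  define node where "node p = ((\<chi> j. fst (p j)) :: complex ^ 'n, \<lambda>j. snd (p j))"
    for p :: "'n \<Rightarrow> complex \<times> nat"
  have inj: "inj_on node A" for A
    by (auto simp: inj_on_def node_def vec_eq_iff fun_eq_iff prod_eq_iff)
  \<comment> \<open>Solves the relation (product of the areas) * (integral of \<open>f\<close>) =
    \<open>vol * V\<close>, where \<open>V\<close> is the constant left after all coordinates are
    processed.\<close>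
  define K where "K = of_real vol / (\<Prod>j\<leftarrow>(coord_list :: 'n list). complex_of_real (area j))"
  define S' where "S' = node ` PiE UNIV S"
  define c' where "c' z \<alpha> = K * (\<Prod>j\<in>UNIV. c j (z $ j) (\<alpha> j))" for z :: "complex ^ 'n" and \<alpha>
  have "has_bochner_integral (lebesgue_on (box_of D)) f (\<Sum>(z, \<alpha>)\<in>S'. c' z \<alpha> * multi_deriv \<alpha> f z)"
    if f_in: "f \<in> bergman (box_of D)" for f
  proof -
    have f: "sep_holomorphic f (box_of D)" "integrable M (\<lambda>z. (cmod (f z))\<^sup>2)"
      using f_in by (auto simp: bergman_iff holomorphic_several_imp_sep_holomorphic)
    have f1: "integrable M f"
      by (intro M.integrable_if_norm_square f(2) borel_measurable_restrict_lborel sep_holomorphicD(1)[OF f(1)])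
    define V where "V = (\<Sum>p\<in>PiE UNIV S. (\<Prod>j\<in>UNIV. c j (fst (p j)) (snd (p j))) *
      multi_deriv (\<lambda>j. snd (p j)) f (\<chi> j. fst (p j)))"
    let ?G = "foldr (\<lambda>j. coord_functional j (S j) (c j)) coord_list f"
    have freeze_UNIV: "freeze UNIV a z = (\<chi> j. a j)" for a and z :: "complex ^ 'n"
      by (simp add: vec_eq_iff)
    have "?G z = V" if "z \<in> box_of D" for z
      using foldr_coord_functional[OF open_D f(1) S coord_list(1) that]
      by (simp add: V_def coord_list(2) multi_deriv_def freeze_UNIV)
    then have "integral\<^sup>L M ?G = (\<integral>z. V \<partial>M)"
      by (intro Bochner_Integration.integral_cong) (auto simp: space_restrict_space)
    also have "\<dots> = of_real vol * V"
      by (simp add: measure_restrict_lborel space_restrict_space open_box scaleR_conv_of_real)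
    finally have "(\<Prod>j\<leftarrow>coord_list. of_real (area j)) * integral\<^sup>L M f = of_real vol * V"
      using foldr_coord_functional_integral(3)[OF f S(2) quad] by simp
    moreover have "(\<Prod>j\<leftarrow>js. complex_of_real (area j)) \<noteq> 0" for js
      using area_pos by (induction js) (auto simp: less_le)
    ultimately have "integral\<^sup>L M f = K * V"
      by (simp add: K_def field_simps)
    also have "\<dots> = (\<Sum>p\<in>PiE UNIV S. case node p of (z, \<alpha>) \<Rightarrow> c' z \<alpha> * multi_deriv \<alpha> f z)"
      by (simp add: V_def c'_def node_def sum_distrib_left mult.assoc)
    also have "\<dots> = (\<Sum>(z, \<alpha>)\<in>S'. c' z \<alpha> * multi_deriv \<alpha> f z)"
      unfolding S'_def by (simp add: sum.reindex[OF inj] o_def)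
    finally show ?thesis
      unfolding has_bochner_integral_box_iff[OF sep_holomorphicD(1)[OF f(1)]]
      using f1 by (simp add: has_bochner_integral_iff)
  qed
  moreover have "finite S'"
    unfolding S'_def using S(1) by (intro finite_imageI finite_PiE) auto
  moreover have "S' \<subseteq> box_of D \<times> UNIV"
  proof -
    have "fst (p j) \<in> D j" if "p \<in> PiE UNIV S" for p j
      using PiE_mem[OF that, of j] S(2)[of j] by auto
    then show ?thesis
      by (auto simp: S'_def node_def box_of_def)
  qed
  ultimately show ?thesis
    unfolding quadrature_domain_def using is_domain_box by blast
qed

section \<open>Functions of a single coordinate and the converse implication\<close>

lemma holomorphic_several_component:
  assumes f: "f holomorphic_on D j"
  shows "holomorphic_several (\<lambda>z. f (z $ j)) (box_of D)"
  unfolding holomorphic_several_def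
proof
  fix z assume "z \<in> box_of D"
  then have "(f has_field_derivative deriv f (z $ j)) (at (z $ j))"
    by (intro holomorphic_derivI[OF f open_D]) (auto simp: box_of_def)
  then have "(f has_derivative (\<lambda>h. deriv f (z $ j) * h)) (at (z $ j))"
    by (simp add: has_field_derivative_def)
  moreover have "((\<lambda>z :: complex ^ 'n. z $ j) has_derivative (\<lambda>v. v $ j)) (at z)"
    by (intro bounded_linear_imp_has_derivative bounded_linear_vec_nth)
  ultimately have "((\<lambda>z. f (z $ j)) has_derivative (\<lambda>v. deriv f (z $ j) * v $ j)) (at z)"
    using diff_chain_at[of "\<lambda>z. z $ j" "\<lambda>v. v $ j" z f] by (simp add: o_def)
  then show "\<exists>D. ((\<lambda>z. f (z $ j)) has_derivative D) (at z) \<and> (\<forall>a v. D (a *s v) = a * D v)"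
    by (intro exI[of _ "\<lambda>v. deriv f (z $ j) * v $ j"]) simp
qed

lemma higher_partial_deriv_component:
  "(partial_deriv i ^^ k) (\<lambda>z :: complex ^ 'n. f (z $ j)) =
    (\<lambda>z. (if i = j then (deriv ^^ k) f else if k = 0 then f else (\<lambda>_. 0)) (z $ j))"
  by (induction k) (auto simp: partial_deriv_coord_upd fun_eq_iff)

text \<open>Claimed for every distinct list, since \<open>coord_list\<close> is an unspecified
  enumeration and the induction passes through its tails. A derivative in a foreign coordinate
  produces zero, which later derivatives preserve.\<close>

lemma foldr_partial_deriv_component:
  assumes "distinct js"
  shows "foldr (\<lambda>i. partial_deriv i ^^ \<alpha> i) js (\<lambda>z :: complex ^ 'n. f (z $ j)) =
    (\<lambda>z. (if \<forall>i\<in>set js - {j}. \<alpha> i = 0 then (if j \<in> set js then (deriv ^^ \<alpha> j) f else f)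
       else (\<lambda>_. 0)) (z $ j))"
  using assms
proof (induction js)
  case Nil
  then show ?case by simp
next
  case (Cons i js)
  have deriv_zero: "(deriv ^^ k) (\<lambda>_. 0 :: complex) = (\<lambda>_. 0)" for k
    by (induction k) (auto simp: fun_eq_iff)
  from Cons.prems have IH: "foldr (\<lambda>i. partial_deriv i ^^ \<alpha> i) js (\<lambda>z :: complex ^ 'n. f (z $ j)) =
    (\<lambda>z. (if \<forall>i\<in>set js - {j}. \<alpha> i = 0 then (if j \<in> set js then (deriv ^^ \<alpha> j) f else f)
       else (\<lambda>_. 0)) (z $ j))"
    by (intro Cons.IH) simp
  have "i \<notin> set js"
    using Cons.prems by simp
  then show ?case
    unfolding foldr.simps o_def IH higher_partial_deriv_component
    by (cases "i = j") (auto simp: fun_eq_iff deriv_zero)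
qed

lemma multi_deriv_component:
  "multi_deriv \<alpha> (\<lambda>z :: complex ^ 'n. f (z $ j)) z =
    (if \<forall>i. i \<noteq> j \<longrightarrow> \<alpha> i = 0 then (deriv ^^ \<alpha> j) f (z $ j) else 0)"
  unfolding multi_deriv_def foldr_partial_deriv_component[OF coord_list(1)] coord_list(2) by auto

lemma quadrature_domain1_factor:
  assumes "quadrature_domain (box_of D)"
  shows "quadrature_domain1 (D j)"
proof -
  obtain S c where S: "finite S" "S \<subseteq> box_of D \<times> UNIV"
    and quad: "\<And>f. f \<in> bergman (box_of D) \<Longrightarrow> has_bochner_integral (lebesgue_on (box_of D)) f
      (\<Sum>(z, \<alpha>)\<in>S. c z \<alpha> * multi_deriv \<alpha> f z)"
    using assms by (auto simp: quadrature_domain_def)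
  \<comment> \<open>Projects a node and its multi-index to the \<open>j\<close>-th factor. Different
    terms may collide, so \<open>c'\<close> sums the coefficients over each fibre.\<close>
  define node where "node s = (fst s $ j, snd s j)" for s :: "(complex ^ 'n) \<times> ('n \<Rightarrow> nat)"
  \<comment> \<open>Terms that differentiate in another coordinate vanish on functions of
    \<open>z $ j\<close>, hence get coefficient 0.\<close>
  define C where "C s = (if \<forall>i. i \<noteq> j \<longrightarrow> snd s i = 0 then c (fst s) (snd s) else 0)" for s
  \<comment> \<open>Inverse of the factor \<open>vol / area j\<close> from
    \<open>has_bochner_integral_component\<close>.\<close>
  define K where "K = complex_of_real (area j / vol)"
  define c' where "c' w k = K * (\<Sum>s | s \<in> S \<and> node s = (w, k). C s)" for w k
  have "has_bochner_integral (lebesgue_on (D j)) f (\<Sum>(w, k)\<in>node ` S. c' w k * (deriv ^^ k) f w)"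
    if f_in: "f \<in> bergman1 (D j)" for f
  proof -
    have f: "f holomorphic_on D j" "integrable (N j) (\<lambda>z. (cmod (f z))\<^sup>2)"
      using f_in by (auto simp: bergman1_iff)
    let ?F = "\<lambda>z :: complex ^ 'n. f (z $ j)"
    have holF: "holomorphic_several ?F (box_of D)"
      by (rule holomorphic_several_component[OF f(1)])
    have f1: "integrable (N j) f"
      by (intro N.integrable_if_norm_square f(2) borel_measurable_restrict_lborel
          holomorphic_on_imp_continuous_on f(1))
    have "integrable M (\<lambda>z. (cmod (?F z))\<^sup>2)"
      using has_bochner_integral_component[OF has_bochner_integral_integrable[OF f(2)]]
      by (simp add: has_bochner_integral_iff)
    then have "has_bochner_integral (lebesgue_on (box_of D)) ?F (\<Sum>(z, \<alpha>)\<in>S. c z \<alpha> * multi_deriv \<alpha> ?F z)"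
      using holF by (intro quad) (simp add: bergman_iff)
    then have "has_bochner_integral M ?F (\<Sum>(z, \<alpha>)\<in>S. c z \<alpha> * multi_deriv \<alpha> ?F z)"
      using holF by (simp add: has_bochner_integral_box_iff sep_holomorphicD(1) holomorphic_several_imp_sep_holomorphic)
    from has_bochner_integral_eq[OF this has_bochner_integral_component[OF has_bochner_integral_integrable[OF f1]]]
    have "(vol / area j) *\<^sub>R integral\<^sup>L (N j) f = (\<Sum>(z, \<alpha>)\<in>S. c z \<alpha> * multi_deriv \<alpha> ?F z)"
      by simp
    also have "\<dots> = (\<Sum>s\<in>S. C s * (deriv ^^ snd (node s)) f (fst (node s)))"
      by (intro sum.cong) (auto simp: multi_deriv_component C_def node_def)
    finally have "integral\<^sup>L (N j) f = K * (\<Sum>s\<in>S. C s * (deriv ^^ snd (node s)) f (fst (node s)))"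
      using area_pos[of j] volume_pos by (simp add: K_def scaleR_conv_of_real field_simps)
    also have "\<dots> = K * (\<Sum>y\<in>node ` S. \<Sum>s | s \<in> S \<and> node s = y. C s * (deriv ^^ snd (node s)) f (fst (node s)))"
      by (simp only: sum.image_gen[OF S(1), of _ node])
    also have "\<dots> = (\<Sum>(w, k)\<in>node ` S. c' w k * (deriv ^^ k) f w)"
      by (simp add: c'_def case_prod_unfold sum_distrib_left sum_distrib_right mult.assoc)
    finally show ?thesis
      unfolding has_bochner_integral_D_iff[OF holomorphic_on_imp_continuous_on[OF f(1)]]
      using f1 by (simp add: has_bochner_integral_iff)
  qed
  moreover have "finite (node ` S)" "node ` S \<subseteq> D j \<times> UNIV"
    using S by (auto simp: node_def box_of_def)
  ultimately show ?thesis
    unfolding quadrature_domain1_def using domain by blast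
qed

end

theorem proposition2p2:
  fixes \<Omega>\<^sub>j :: "'n::finite \<Rightarrow> complex set" and \<Omega> :: "(complex ^ 'n) set"
  assumes prod: "\<Omega> = {z. \<forall>j. z $ j \<in> \<Omega>\<^sub>j j}"
    and volume: "emeasure lebesgue \<Omega> < \<infinity>"
    and factor_domain: "\<And>j. is_domain (\<Omega>\<^sub>j j)"
    and area: "\<And>j. emeasure lebesgue (\<Omega>\<^sub>j j) < \<infinity>"
  shows "quadrature_domain \<Omega> \<longleftrightarrow> (\<forall>j. quadrature_domain1 (\<Omega>\<^sub>j j))"
proof -
  have \<Omega>: "\<Omega> = box_of \<Omega>\<^sub>j"
    by (simp add: prod box_of_def)
  have op: "open (\<Omega>\<^sub>j j)" for j
    using factor_domain[of j] by (simp add: is_domain_def)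
  have "open \<Omega>"
    unfolding \<Omega> by (rule open_box_of[OF op])
  \<comment> \<open>All sets involved are open, hence Borel, so the Lebesgue measures in the
    hypotheses agree with \<open>lborel\<close> in the locale.\<close>
  then interpret finite_domains \<Omega>\<^sub>j
    using op volume area factor_domain by unfold_locales (auto simp flip: \<Omega>)
  show ?thesis
    using quadrature_domain_box quadrature_domain1_factor by (auto simp: \<Omega>)
qed

end
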